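(* For any fixed $\eta\in S_n$ we have in $Fun(GL_{r,s}(n))$ $$\det{}_{r,s}T=(-s)^{-l(\eta)}\sum_{\sigma\in S_n}(-s)^{l(\sigma)}t_{\sigma(1),\eta(1)}\cdots t_{\sigma(n),\eta(n)}=(-r)^{l(\eta)}\sum_{\sigma\in S_n}(-r)^{-l(\sigma)}t_{\eta(1),\sigma(1)}\cdots t_{\eta(n),\sigma(n)}.$$ In particular, $$\det{}_{r,s}T=\sum_{\sigma\in S_n}(-s)^{l(\sigma)}t_{\sigma(1),1}\cdots t_{\sigma(n),n}=\sum_{\sigma\in S_n}(-r)^{-l(\sigma)}t_{1,\sigma(1)}\cdots t_{n,\sigma(n)}.$$
   Context: Let $n\ge 2$ and let $r,s\in\mathbb{C}$ be nonzero with $r\neq s$ and $[k]_{r,s}:=\frac{s^k-r^k}{s-r}\neq 0$ for $1\le k\le n$ (in particular $r+s\neq 0$); put $[n]_{r,s}!=[1]_{r,s}\cdots[n]_{r,s}$. Let $V=\mathbb{C}^n$ with column basis vectors $e^i$, dual row basis vectors $e_i$, and matrix units $e_{ij}$ with $e_{ij}e^k=\delta_{jk}e^i$. Define $R\in End(V\otimes V)$ by $$R=s\sum_{i}e_{ii}\otimes e_{ii}+rs\sum_{i>j}e_{ii}\otimes e_{jj}+\sum_{i<j}e_{ii}\otimes e_{jj}+(s-r)\sum_{i>j}e_{ij}\otimes e_{ji}.$$ $A(R)$ is the unital associative $\mathbb{C}$-algebra generated by $t_{ij}$, $1\le i,j\le n$, with relations $RT_1T_2=T_2T_1R$, where $T=(t_{ij})$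 and $T_k$ denotes $\sum_{i,j}t_{ij}\otimes(1^{\otimes(k-1)}\otimes e_{ij}\otimes 1\otimes\cdots\otimes 1)$, i.e. $T$ acting in the $k$-th tensor factor of $V$. $Fun(GL_{r,s}(n))$ is the associative algebra generated by $t_{ij},t'_{ij}$ subject to the relations of $A(R)$ for the $t_{ij}$ together with $\sum_k t'_{ik}t_{kj}=\sum_k t_{ik}t'_{kj}=\delta_{ij}\cdot 1$. Let $l(\sigma)$ be the number of inversions of $\sigma\in S_n$, and set $$\langle\varepsilon|=\frac{1}{[n]_{r,s}!}\sum_{\sigma\in S_n}(-s)^{l(\sigma)}e_{\sigma(1)}\otimes\cdots\otimes e_{\sigma(n)},\qquad |\varepsilon\rangle=r^{\frac{n(n-1)}{2}}\sum_{\sigma\in S_n}(-r)^{-l(\sigma)}e^{\sigma(1)}\otimes\cdots\otimes e^{\sigma(n)}.$$ The quantum determinant is $\det_{r,s}T=\langle\varepsilon|T_1\cdots T_n|\varepsilon\rangle\in Fun(GL_{r,s}(n))$. *)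

theory Defs
  imports
    "HOL-Library.Poly_Mapping"
    "HOL-Combinatorics.Permutations"
    "HOL-Algebra.QuotRing"
    "HOL-Algebra.Module"
    Complex_Main
begin

section \<open>Free associative algebras and their quotients\<close>

text \<open>
  The free monoid is wrapped in a datatype and written additively, so that the convolution
  product of \<^theory>\<open>HOL-Library.Poly_Mapping\<close> is concatenation of words.
\<close>

datatype 'g word = Word (letters: "'g list")

instantiation word :: (type) monoid_add
begin

definition zero_word :: "'a word" where
  "0 = Word []"

definition plus_word :: "'a word \<Rightarrow> 'a word \<Rightarrow> 'a word" where
  "u + v = Word (letters u @ letters v)"

instance
  by standard (simp_all add: zero_word_def plus_word_def)

end

text \<open>
  Associative complex algebras are represented by the record type of modules, which extends
  rings by a scalar multiplication.
\<close>

type_synonym 'a calg = "(complex, 'a) module"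

definition free_algebra :: "'g set \<Rightarrow> ('g word \<Rightarrow>\<^sub>0 complex) calg" where
  "free_algebra X =
    \<lparr>carrier = {p. \<forall>w \<in> Poly_Mapping.keys p. set (letters w) \<subseteq> X},
     mult = (*), one = 1, zero = 0, add = (+),
     smult = (\<lambda>c p. Poly_Mapping.single 0 c * p)\<rparr>"

definition free_gen :: "'g \<Rightarrow> 'g word \<Rightarrow>\<^sub>0 complex" where
  "free_gen g = Poly_Mapping.single (Word [g]) 1"

text \<open>Scalars act on a coset through its representatives, as for \<^const>\<open>rcoset_mult\<close>.\<close>

definition quotient_algebra :: "'a calg \<Rightarrow> 'a set \<Rightarrow> 'a set calg" where
  "quotient_algebra A I =
    ring.extend (A Quot I) (module.fields (\<lambda>c X. \<Union>x\<in>X. I +>\<^bsub>A\<^esub> (c \<odot>\<^bsub>A\<^esub> x)))"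

lemma ring_free_algebra: "ring (free_algebra X)"
proof -
  let ?A = "free_algebra X"
  have add: "p + q \<in> carrier ?A" if "p \<in> carrier ?A" "q \<in> carrier ?A" for p q
    using that Poly_Mapping.keys_add[of p q] by (fastforce simp: free_algebra_def)
  have mult: "p * q \<in> carrier ?A" if "p \<in> carrier ?A" "q \<in> carrier ?A" for p q
    using that keys_mult[of p q] by (fastforce simp: free_algebra_def plus_word_def)
  have one: "1 \<in> carrier ?A" and zero: "0 \<in> carrier ?A"
    by (simp_all add: free_algebra_def zero_word_def)
  have uminus: "- p \<in> carrier ?A" if "p \<in> carrier ?A" for p
    using that by (simp add: free_algebra_def in_keys_iff)
  have ops: "x \<otimes>\<^bsub>?A\<^esub> y = x * y" "x \<oplus>\<^bsub>?A\<^esub> y = x + y" "\<one>\<^bsub>?A\<^esub> = 1" "\<zero>\<^bsub>?A\<^esub> = 0" for x y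
    by (simp_all add: free_algebra_def)
  show ?thesis
  proof (rule ringI)
    show "abelian_group ?A"
    proof (rule abelian_groupI)
      show "\<exists>q\<in>carrier ?A. q \<oplus>\<^bsub>?A\<^esub> p = \<zero>\<^bsub>?A\<^esub>" if "p \<in> carrier ?A" for p
        using uminus[OF that] by (intro bexI[of _ "- p"]) (simp_all add: ops)
    qed (simp_all add: ops add zero add.assoc add.commute)
    show "monoid ?A"
      by (rule monoidI) (simp_all add: ops mult one mult.assoc)
  qed (simp_all add: ops distrib_left distrib_right)
qed


section \<open>Operators on tensor powers of \<open>\<complex>\<^sup>n\<close>\<close>

text \<open>
  The basis of \<open>V\<^bsup>\<otimes>m\<^esup>\<close> is indexed by lists of length \<open>m\<close> over \<open>{1..n}\<close>; an element of
  \<open>A \<otimes> End(V\<^bsup>\<otimes>m\<^esup>)\<close> is given by its matrix \<open>M I J\<close> (row \<open>I\<close>, column \<open>J\<close>) with entries in \<open>A\<close>.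
\<close>

definition multi_indices :: "nat \<Rightarrow> nat \<Rightarrow> nat list set" where
  "multi_indices n m = {I. length I = m \<and> set I \<subseteq> {1..n}}"

type_synonym 'a tensor_op = "nat list \<Rightarrow> nat list \<Rightarrow> 'a"

definition id_mat :: "nat \<Rightarrow> nat \<Rightarrow> complex" where
  "id_mat a b = of_bool (a = b)"

definition unit_mat :: "nat \<Rightarrow> nat \<Rightarrow> nat \<Rightarrow> nat \<Rightarrow> complex" where
  "unit_mat i j a b = of_bool (a = i \<and> b = j)"

definition unit_vec :: "nat \<Rightarrow> nat \<Rightarrow> complex" where
  "unit_vec i a = of_bool (a = i)"

definition tensor_mat :: "(nat \<Rightarrow> nat \<Rightarrow> complex) list \<Rightarrow> complex tensor_op" where
  "tensor_mat Ms I J = (\<Prod>p<length Ms. (Ms ! p) (I ! p) (J ! p))"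

definition tensor_vec :: "(nat \<Rightarrow> complex) list \<Rightarrow> nat list \<Rightarrow> complex" where
  "tensor_vec vs I = (\<Prod>p<length vs. (vs ! p) (I ! p))"

definition scalar_op :: "'a calg \<Rightarrow> complex tensor_op \<Rightarrow> 'a tensor_op" where
  "scalar_op A M = (\<lambda>I J. M I J \<odot>\<^bsub>A\<^esub> \<one>\<^bsub>A\<^esub>)"

definition op_mult :: "'a calg \<Rightarrow> nat \<Rightarrow> nat \<Rightarrow> 'a tensor_op \<Rightarrow> 'a tensor_op \<Rightarrow> 'a tensor_op" where
  "op_mult A n m M N = (\<lambda>I J. \<Oplus>\<^bsub>A\<^esub>K\<in>multi_indices n m. M I K \<otimes>\<^bsub>A\<^esub> N K J)"

definition op_one :: "'a calg \<Rightarrow> nat \<Rightarrow> 'a tensor_op" where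
  "op_one A m = scalar_op A (tensor_mat (replicate m id_mat))"

text \<open>The operator \<open>T\<^sub>k\<close> on the \<open>m\<close>-fold tensor power, for \<open>1 \<le> k \<le> m\<close>.\<close>

definition leg_op :: "'a calg \<Rightarrow> nat \<Rightarrow> nat \<Rightarrow> (nat \<Rightarrow> nat \<Rightarrow> 'a) \<Rightarrow> nat \<Rightarrow> 'a tensor_op" where
  "leg_op A n m t k = (\<lambda>I J. \<Oplus>\<^bsub>A\<^esub>i\<in>{1..n}. \<Oplus>\<^bsub>A\<^esub>j\<in>{1..n}.
     tensor_mat (replicate (k - 1) id_mat @ [unit_mat i j] @ replicate (m - k) id_mat) I J
       \<odot>\<^bsub>A\<^esub> t i j)"

definition R_mat :: "nat \<Rightarrow> complex \<Rightarrow> complex \<Rightarrow> complex tensor_op" where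
  "R_mat n r s = (\<lambda>I J.
     s * (\<Sum>i\<in>{1..n}. tensor_mat [unit_mat i i, unit_mat i i] I J)
     + r * s * (\<Sum>(i, j)\<in>{(i, j). i \<in> {1..n} \<and> j \<in> {1..n} \<and> i > j}.
         tensor_mat [unit_mat i i, unit_mat j j] I J)
     + (\<Sum>(i, j)\<in>{(i, j). i \<in> {1..n} \<and> j \<in> {1..n} \<and> i < j}.
         tensor_mat [unit_mat i i, unit_mat j j] I J)
     + (s - r) * (\<Sum>(i, j)\<in>{(i, j). i \<in> {1..n} \<and> j \<in> {1..n} \<and> i > j}.
         tensor_mat [unit_mat i j, unit_mat j i] I J))"


section \<open>The algebra \<open>Fun(GL\<^bsub>r,s\<^esub>(n))\<close>\<close>

datatype GL_gen = T nat nat | T' nat nat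

definition GL_free :: "nat \<Rightarrow> (GL_gen word \<Rightarrow>\<^sub>0 complex) calg" where
  "GL_free n =
    free_algebra ({T i j |i j. i \<in> {1..n} \<and> j \<in> {1..n}} \<union> {T' i j |i j. i \<in> {1..n} \<and> j \<in> {1..n}})"

definition RTT_relators :: "nat \<Rightarrow> complex \<Rightarrow> complex \<Rightarrow> (GL_gen word \<Rightarrow>\<^sub>0 complex) set" where
  "RTT_relators n r s =
    (let A = GL_free n;
         R = scalar_op A (R_mat n r s);
         T\<^sub>1 = leg_op A n 2 (\<lambda>i j. free_gen (T i j)) 1;
         T\<^sub>2 = leg_op A n 2 (\<lambda>i j. free_gen (T i j)) 2
     in {op_mult A n 2 R (op_mult A n 2 T\<^sub>1 T\<^sub>2) I J \<ominus>\<^bsub>A\<^esub> op_mult A n 2 (op_mult A n 2 T\<^sub>2 T\<^sub>1) R I J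
         |I J. I \<in> multi_indices n 2 \<and> J \<in> multi_indices n 2})"

definition inverse_relators :: "nat \<Rightarrow> (GL_gen word \<Rightarrow>\<^sub>0 complex) set" where
  "inverse_relators n =
    (let A = GL_free n; t = (\<lambda>i j. free_gen (T i j)); t' = (\<lambda>i j. free_gen (T' i j))
     in {(\<Oplus>\<^bsub>A\<^esub>k\<in>{1..n}. t' i k \<otimes>\<^bsub>A\<^esub> t k j) \<ominus>\<^bsub>A\<^esub> id_mat i j \<odot>\<^bsub>A\<^esub> \<one>\<^bsub>A\<^esub> |i j. i \<in> {1..n} \<and> j \<in> {1..n}}
      \<union> {(\<Oplus>\<^bsub>A\<^esub>k\<in>{1..n}. t i k \<otimes>\<^bsub>A\<^esub> t' k j) \<ominus>\<^bsub>A\<^esub> id_mat i j \<odot>\<^bsub>A\<^esub> \<one>\<^bsub>A\<^esub> |i j. i \<in> {1..n} \<and> j \<in> {1..n}})"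

text \<open>In HOL-Algebra, ideals (and hence \<open>Idl\<close>) are two-sided.\<close>

definition GL_ideal :: "nat \<Rightarrow> complex \<Rightarrow> complex \<Rightarrow> (GL_gen word \<Rightarrow>\<^sub>0 complex) set" where
  "GL_ideal n r s = Idl\<^bsub>GL_free n\<^esub> (RTT_relators n r s \<union> inverse_relators n)"

definition Fun_GL :: "nat \<Rightarrow> complex \<Rightarrow> complex \<Rightarrow> (GL_gen word \<Rightarrow>\<^sub>0 complex) set calg" where
  "Fun_GL n r s = quotient_algebra (GL_free n) (GL_ideal n r s)"

definition GL_t :: "nat \<Rightarrow> complex \<Rightarrow> complex \<Rightarrow> nat \<Rightarrow> nat \<Rightarrow> (GL_gen word \<Rightarrow>\<^sub>0 complex) set" where
  "GL_t n r s i j = GL_ideal n r s +>\<^bsub>GL_free n\<^esub> free_gen (T i j)"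


section \<open>The quantum determinant\<close>

definition qint :: "complex \<Rightarrow> complex \<Rightarrow> nat \<Rightarrow> complex" where
  "qint r s k = (s ^ k - r ^ k) / (s - r)"

definition qfact :: "complex \<Rightarrow> complex \<Rightarrow> nat \<Rightarrow> complex" where
  "qfact r s n = (\<Prod>k\<in>{1..n}. qint r s k)"

definition inversions :: "nat \<Rightarrow> (nat \<Rightarrow> nat) \<Rightarrow> nat" where
  "inversions n \<sigma> = card {(i, j). i \<in> {1..n} \<and> j \<in> {1..n} \<and> i < j \<and> \<sigma> i > \<sigma> j}"

definition eps_bra :: "nat \<Rightarrow> complex \<Rightarrow> complex \<Rightarrow> nat list \<Rightarrow> complex" where
  "eps_bra n r s I = 1 / qfact r s n *
     (\<Sum>\<sigma> | \<sigma> permutes {1..n}.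
        (- s) ^ inversions n \<sigma> * tensor_vec (map (\<lambda>k. unit_vec (\<sigma> k)) [1..<n+1]) I)"

definition eps_ket :: "nat \<Rightarrow> complex \<Rightarrow> nat list \<Rightarrow> complex" where
  "eps_ket n r I = r ^ (n * (n - 1) div 2) *
     (\<Sum>\<sigma> | \<sigma> permutes {1..n}.
        (- r) powi (- int (inversions n \<sigma>)) * tensor_vec (map (\<lambda>k. unit_vec (\<sigma> k)) [1..<n+1]) I)"

definition qdet :: "nat \<Rightarrow> complex \<Rightarrow> complex \<Rightarrow> (GL_gen word \<Rightarrow>\<^sub>0 complex) set" where
  "qdet n r s =
    (let A = Fun_GL n r s;
         Ts = foldr (op_mult A n n) (map (leg_op A n n (GL_t n r s)) [1..<n+1]) (op_one A n)
     in \<Oplus>\<^bsub>A\<^esub>I\<in>multi_indices n n. \<Oplus>\<^bsub>A\<^esub>J\<in>multi_indices n n.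
          (eps_bra n r s I * eps_ket n r J) \<odot>\<^bsub>A\<^esub> Ts I J)"

definition ordered_prod :: "('a, 'b) monoid_scheme \<Rightarrow> nat \<Rightarrow> (nat \<Rightarrow> 'a) \<Rightarrow> 'a" where
  "ordered_prod A n x = foldr (\<otimes>\<^bsub>A\<^esub>) (map x [1..<n+1]) \<one>\<^bsub>A\<^esub>"

end

theory Submission
  imports Defs "HOL-Combinatorics.Multiset_Permutations"
begin

text \<open>
  Write \<open>D(\<eta>) = \<Sum>\<sigma>. (-s)\<^sup>l\<^sup>(\<^sup>\<sigma>\<^sup>) t\<^bsub>\<sigma>(1),\<eta>(1)\<^esub> \<cdots> t\<^bsub>\<sigma>(n),\<eta>(n)\<^esub>\<close>. The heart of the matter is that
  \<open>D(\<eta>) = (-s)\<^sup>l\<^sup>(\<^sup>\<eta>\<^sup>) D(id)\<close>. It suffices to see how \<open>D\<close> changes when two neighbouring entries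
  \<open>c < d\<close> of \<open>\<eta>\<close> are exchanged, since every permutation is sorted by exchanging neighbours, each
  exchange removing one inversion. In the sum, the terms belonging to \<open>\<sigma>\<close> and to \<open>\<sigma>\<close> with
  the same two positions exchanged share all their other factors, so the claim for \<open>D\<close> reduces to
  one identity between quadratic expressions: for \<open>a < b\<close> and \<open>c < d\<close>,

  \<open>t\<^bsub>ad\<^esub> t\<^bsub>bc\<^esub> - s t\<^bsub>bd\<^esub> t\<^bsub>ac\<^esub> = -s (t\<^bsub>ac\<^esub> t\<^bsub>bd\<^esub> - s t\<^bsub>bc\<^esub> t\<^bsub>ad\<^esub>)\<close>.

  This is a linear combination of the two instances of \<open>R T\<^sub>1 T\<^sub>2 = T\<^sub>2 T\<^sub>1 R\<close>

  \<open>t\<^bsub>ad\<^esub> t\<^bsub>bc\<^esub> = r s t\<^bsub>bc\<^esub> t\<^bsub>ad\<^esub>\<close> and \<open>t\<^bsub>ac\<^esub> t\<^bsub>bd\<^esub> - t\<^bsub>bd\<^esub> t\<^bsub>ac\<^esub> = (s - r) t\<^bsub>bc\<^esub> t\<^bsub>ad\<^esub>\<close>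

  (\<open>exchange_relations\<close>). The sums over the column index behave in the same way with \<open>-s\<close> replaced
  by \<open>(-r)\<^sup>-\<^sup>1\<close>; another combination of the same two relations gives their exchange identity.

  The matrix entries of \<open>T\<^sub>1 \<cdots> T\<^sub>n\<close> are the monomials \<open>t\<^bsub>i\<^sub>1j\<^sub>1\<^esub> \<cdots> t\<^bsub>i\<^sub>nj\<^sub>n\<^esub>\<close> (\<open>legs_free\<close>), so
  the determinant is a double sum over pairs \<open>(\<sigma>, \<tau>)\<close> of permutations. Its inner sum over \<open>\<sigma>\<close> is
  \<open>D(\<tau>) = (-s)\<^sup>l\<^sup>(\<^sup>\<tau>\<^sup>) D(id)\<close>, and what remains is the scalar
  \<open>r\<^sup>n\<^sup>(\<^sup>n\<^sup>-\<^sup>1\<^sup>)\<^sup>/\<^sup>2 \<Sum>\<tau>. (s/r)\<^sup>l\<^sup>(\<^sup>\<tau>\<^sup>)\<close>, which equals \<open>[n]!\<close> by the product formula for the generating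
  function of inversions (\<open>qfact_eq_inversion_sum\<close>). The combinatorial part of this argument
  (\<open>q_determinant_congruent\<close>) is linear and is carried out once, for families of vectors modulo a
  subspace, and then used for rows and for columns.

  All computations with generators take place in the free algebra, where ordinary sums and products
  are available, and modulo the defining ideal; a coset map that respects products and scalars
  (\<open>calg_hom\<close>) carries them over to the quotient. Permutations are handled as words
  \<open>[\<sigma> 1, \<dots>, \<sigma> n]\<close>, which are at the same time the indices of the basis of the tensor power.
\<close>

section \<open>Inversions of permutations written as words\<close>

text \<open>
  The recursion compares the first letter with the set of the later ones; for words without
  repeated letters this counts the inversions.
\<close>

fun list_inversions :: "'a::linorder list \<Rightarrow> nat" where
  "list_inversions [] = 0"
| "list_inversions (x # xs) = card {y \<in> set xs. y < x} + list_inversions xs"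

text \<open>
  Exchanging two neighbours in a word does not affect the comparison of any other pair of entries.
\<close>

lemma list_inversions_swap:
  assumes "distinct (xs @ a # b # ys)" and "a < b"
  shows "list_inversions (xs @ b # a # ys) = Suc (list_inversions (xs @ a # b # ys))"
  using assms
proof (induction xs)
  case Nil
  have "{y. (y = a \<or> y \<in> set ys) \<and> y < b} = insert a {y \<in> set ys. y < b}"
    and "{y. (y = b \<or> y \<in> set ys) \<and> y < a} = {y \<in> set ys. y < a}"
    using Nil by auto
  with Nil show ?case by simp
next
  case (Cons x xs)
  have "set (xs @ b # a # ys) = set (xs @ a # b # ys)" by auto
  with Cons show ?case by (simp only: append_Cons list_inversions.simps) simp
qed

lemma not_sorted_descent:
  assumes "\<not> sorted xs"
  obtains us d c vs where "xs = us @ d # c # vs" and "c < (d :: 'a::linorder)"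
proof -
  have "\<exists>us d c vs. xs = us @ d # c # vs \<and> c < d"
    using assms
  proof (induction xs)
    case (Cons x xs)
    show ?case
    proof (cases "sorted xs")
      case True
      with Cons.prems obtain c vs where "xs = c # vs"
        by (cases xs) auto
      with True Cons.prems have "c < x"
        by (auto simp: not_le)
      with \<open>xs = c # vs\<close> show ?thesis by (metis append_Nil)
    next
      case False
      then show ?thesis using Cons.IH by (metis append_Cons)
    qed
  qed simp
  with that show thesis by blast
qed

text \<open>
  The number of smaller elements takes each of the values \<open>0, \<dots>, card A - 1\<close> exactly once.
\<close>

lemma sum_power_card_less:
  fixes q :: "'b::comm_semiring_1" and A :: "'a::linorder set"
  assumes "finite A"
  shows "(\<Sum>x\<in>A. q ^ card {y \<in> A. y < x}) = (\<Sum>i<card A. q ^ i)"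
  using assms
proof (induction A rule: finite_linorder_max_induct)
  case (insert b A)
  then have "{y \<in> insert b A. y < b} = A"
    and "x \<in> A \<Longrightarrow> {y \<in> insert b A. y < x} = {y \<in> A. y < x}" for x
    by auto
  moreover have "b \<notin> A" using insert by auto
  ultimately show ?case using insert by (simp add: add.commute)
qed simp

text \<open>
  The first letter \<open>x\<close> of a word contributes as many inversions as there are letters below it, and the
  remaining letters form an arbitrary permutation of \<open>A - {x}\<close>; so each letter in turn contributes one
  factor to the product.
\<close>

lemma sum_power_list_inversions:
  fixes q :: "'b::comm_semiring_1" and A :: "'a::linorder set"
  assumes "finite A"
  shows "(\<Sum>xs\<in>permutations_of_set A. q ^ list_inversions xs) = (\<Prod>k=1..card A. \<Sum>i<k. q ^ i)"
  using assms
proof (induction "card A" arbitrary: A)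
  case (Suc m A)
  have nonempty: "A \<noteq> {}" using Suc.hyps(2) by auto
  have "(\<Sum>xs\<in>permutations_of_set A. q ^ list_inversions xs)
      = (\<Sum>x\<in>A. \<Sum>xs\<in>(#) x ` permutations_of_set (A - {x}). q ^ list_inversions xs)"
    unfolding permutations_of_set_nonempty[OF nonempty] using Suc.prems
    by (intro sum.UNION_disjoint) auto
  also have "\<dots> = (\<Sum>x\<in>A. q ^ card {y \<in> A. y < x} *
      (\<Sum>xs\<in>permutations_of_set (A - {x}). q ^ list_inversions xs))"
  proof (rule sum.cong[OF refl])
    fix x assume "x \<in> A"
    have "{y \<in> set xs. y < x} = {y \<in> A. y < x}" if "xs \<in> permutations_of_set (A - {x})" for xs
      using permutations_of_setD(1)[OF that] by auto
    then show "(\<Sum>xs\<in>(#) x ` permutations_of_set (A - {x}). q ^ list_inversions xs)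
        = q ^ card {y \<in> A. y < x} * (\<Sum>xs\<in>permutations_of_set (A - {x}). q ^ list_inversions xs)"
      by (simp add: sum.reindex power_add sum_distrib_left)
  qed
  also have "\<dots> = (\<Sum>x\<in>A. q ^ card {y \<in> A. y < x}) * (\<Prod>k=1..m. \<Sum>i<k. q ^ i)"
    unfolding sum_distrib_right
  proof (rule sum.cong[OF refl])
    fix x assume "x \<in> A"
    then have "m = card (A - {x})" using Suc by simp
    then show "q ^ card {y \<in> A. y < x} * (\<Sum>xs\<in>permutations_of_set (A - {x}). q ^ list_inversions xs)
        = q ^ card {y \<in> A. y < x} * (\<Prod>k=1..m. \<Sum>i<k. q ^ i)"
      using Suc.hyps(1)[of "A - {x}"] Suc.prems by simp
  qed
  also have "\<dots> = (\<Prod>k=1..card A. \<Sum>i<k. q ^ i)"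
    using sum_power_card_less[OF Suc.prems, of q] Suc.hyps(2)[symmetric]
    by (simp add: mult.commute)
  finally show ?case .
qed simp

text \<open>
  The two-parameter integer \<open>[k + 1]\<close> is the geometric sum \<open>1 + q + \<cdots> + q\<^sup>k\<close> at \<open>q = s/r\<close>, scaled by
  \<open>r\<^sup>k\<close>. The scaling factors multiply up to the power of \<open>r\<close> that normalizes \<open>eps_ket\<close>.
\<close>

lemma qfact_eq_inversion_sum:
  assumes "r \<noteq> 0" and "r \<noteq> s"
  shows "qfact r s n = r ^ (n * (n - 1) div 2) *
    (\<Sum>xs\<in>permutations_of_set {1..n}. (s / r) ^ list_inversions xs)"
proof -
  have qint: "qint r s (Suc k) = r ^ k * (\<Sum>i<Suc k. (s / r) ^ i)" for k
  proof -
    have "s / r \<noteq> 1" using assms by simp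
    then have "(\<Sum>i<Suc k. (s / r) ^ i) = ((s / r) ^ Suc k - 1) / (s / r - 1)"
      by (rule geometric_sum)
    moreover have "qint r s (Suc k) = r ^ k * (((s / r) ^ Suc k - 1) / (s / r - 1))"
      using assms by (simp add: qint_def power_divide field_simps)
    ultimately show ?thesis by (simp only:)
  qed
  have "qfact r s n = r ^ (n * (n - 1) div 2) * (\<Prod>k=1..n. \<Sum>i<k. (s / r) ^ i)"
  proof (induction n)
    case (Suc n)
    have "Suc n * (Suc n - 1) div 2 = n * (n - 1) div 2 + n"
      by (cases n) (simp_all add: algebra_simps)
    moreover have "qfact r s (Suc n) = qfact r s n * qint r s (Suc n)"
      by (simp add: qfact_def)
    ultimately show ?case by (simp only: Suc qint power_add) simp
  qed (simp add: qfact_def)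
  then show ?thesis
    by (simp add: sum_power_list_inversions)
qed

lemma list_inversions_conv_card:
  assumes "distinct xs"
  shows "list_inversions xs = card {(i, j). i < j \<and> j < length xs \<and> xs ! j < xs ! i}"
  using assms
proof (induction xs)
  case (Cons x xs)
  let ?N = "\<lambda>xs. {(i, j). i < j \<and> j < length xs \<and> xs ! j < xs ! i}"
  let ?J = "{j. j < length xs \<and> xs ! j < x}"
  have fin: "finite (?N xs)"
    by (rule finite_subset[of _ "{..<length xs} \<times> {..<length xs}"]) auto
  have split: "?N (x # xs) = (\<lambda>j. (0, Suc j)) ` ?J \<union> map_prod Suc Suc ` ?N xs" (is "?L = ?R")
  proof (rule Set.set_eqI)
    fix p :: "nat \<times> nat"
    obtain i j where "p = (i, j)" by (cases p)
    then show "p \<in> ?L \<longleftrightarrow> p \<in> ?R"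
      by (cases i; cases j) (auto simp: image_iff)
  qed
  have "bij_betw ((!) xs) ?J {y \<in> set xs. y < x}"
    using Cons.prems by (auto simp: bij_betw_def inj_on_def nth_eq_iff_index_eq in_set_conv_nth)
  then have "card ?J = card {y \<in> set xs. y < x}" by (rule bij_betw_same_card)
  moreover have "card (?N (x # xs)) = card ?J + card (?N xs)"
    unfolding split using fin
    by (subst card_Un_disjoint) (auto simp: card_image inj_on_def)
  ultimately show ?case using Cons by simp
qed simp

lemma list_inversions_map:
  assumes "\<sigma> permutes {1..n}"
  shows "list_inversions (map \<sigma> [1..<n+1]) = inversions n \<sigma>"
proof -
  have "distinct (map \<sigma> [1..<n+1])"
    using permutes_inj_on[OF assms] by (auto simp: distinct_map)
  then have "list_inversions (map \<sigma> [1..<n+1])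
      = card {(i, j). i < j \<and> j < n \<and> \<sigma> (Suc j) < \<sigma> (Suc i)}"
    by (subst list_inversions_conv_card) (auto intro!: arg_cong[of _ _ card] simp del: upt_Suc)
  also have "\<dots> = inversions n \<sigma>"
    unfolding inversions_def
  proof (rule bij_betw_same_card)
    show "bij_betw (map_prod Suc Suc) {(i, j). i < j \<and> j < n \<and> \<sigma> (Suc j) < \<sigma> (Suc i)}
      {(i, j). i \<in> {1..n} \<and> j \<in> {1..n} \<and> i < j \<and> \<sigma> i > \<sigma> j}"
      by (rule bij_betw_byWitness[where f' = "map_prod (\<lambda>i. i - 1) (\<lambda>i. i - 1)"]) auto
  qed
  finally show ?thesis .
qed

lemma bij_betw_permutes_permutations_of_set:
  "bij_betw (\<lambda>\<sigma>. map \<sigma> [1..<n+1]) {\<sigma>. \<sigma> permutes {1..n}} (permutations_of_set {1..n})"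
  (is "bij_betw ?f ?P ?L")
proof -
  have inj: "inj_on ?f ?P"
  proof (rule inj_onI)
    fix \<sigma> \<tau> assume "\<sigma> \<in> ?P" "\<tau> \<in> ?P" and eq: "?f \<sigma> = ?f \<tau>"
    then have "\<sigma> k = \<tau> k" for k
      by (cases "k \<in> {1..n}") (auto simp: permutes_not_in simp del: upt_Suc)
    then show "\<sigma> = \<tau>" by blast
  qed
  have "?f \<sigma> \<in> ?L" if "\<sigma> permutes {1..n}" for \<sigma>
  proof (rule permutations_of_setI)
    have "set (map \<sigma> [1..<n+1]) = \<sigma> ` {1..n}" by (auto simp del: upt_Suc)
    then show "set (map \<sigma> [1..<n+1]) = {1..n}"
      using permutes_image[OF that] by simp
    show "distinct (map \<sigma> [1..<n+1])"
      using permutes_inj_on[OF that] by (auto simp: distinct_map)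
  qed
  then have "?f ` ?P \<subseteq> ?L" by blast
  moreover have "card (?f ` ?P) = card ?L"
    using card_image[OF inj] card_permutations[of "{1..n}" n] by simp
  ultimately have "?f ` ?P = ?L"
    by (intro card_subset_eq) auto
  with inj show ?thesis by (simp add: bij_betw_def)
qed

section \<open>q-alternating sums modulo a subspace\<close>

context vector_space
begin

text \<open>
  Two words that differ by an exchange at positions \<open>k\<close> and \<open>k + 1\<close> are grouped together. The one with
  a descent there has one inversion more, so its weight carries an additional factor \<open>q\<close> and the
  group contributes a multiple of a vector that lies in \<open>S\<close> by hypothesis.
\<close>

lemma q_alternating_sum_mem_subspace:
  fixes h :: "'i::linorder list \<Rightarrow> 'b"
  assumes S: "subspace S" and k: "Suc k < card A"
    and pair: "\<And>ps a b qs. length ps = k \<Longrightarrow> a < b \<Longrightarrow> ps @ a # b # qs \<in> permutations_of_set A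
      \<Longrightarrow> h (ps @ a # b # qs) + q *s h (ps @ b # a # qs) \<in> S"
  shows "(\<Sum>xs\<in>permutations_of_set A. (q ^ list_inversions xs) *s h xs) \<in> S"
proof -
  let ?P = "permutations_of_set A"
  define sw where "sw xs = xs[k := xs ! Suc k, Suc k := xs ! k]" for xs :: "'i list"
  \<comment> \<open>One representative of each pair of words that are exchanged by \<open>sw\<close>.\<close>
  define Asc where "Asc = {xs \<in> ?P. xs ! k < xs ! Suc k}"
  have len: "length xs = card A" if "xs \<in> ?P" for xs
    using that by (rule length_finite_permutations_of_set)
  have split: "\<exists>ps a b qs. xs = ps @ a # b # qs \<and> length ps = k" if "xs \<in> ?P" for xs
  proof -
    have "xs = take k xs @ xs ! k # xs ! Suc k # drop (Suc (Suc k)) xs"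
      using k len[OF that] by (simp add: Cons_nth_drop_Suc)
    moreover have "length (take k xs) = k" using k len[OF that] by simp
    ultimately show ?thesis by blast
  qed
  have sw_append: "sw (ps @ a # b # qs) = ps @ b # a # qs" if "length ps = k" for ps a b qs
    using that by (simp add: sw_def nth_append list_update_append)
  have perm_swap: "ps @ b # a # qs \<in> ?P" if "ps @ a # b # qs \<in> ?P" for ps a b qs
    using that by (auto simp: permutations_of_set_def)
  have sw_sw: "sw (sw xs) = xs" and sw_P: "sw xs \<in> ?P" if "xs \<in> ?P" for xs
    using split[OF that] that by (auto simp: sw_append intro: perm_swap)
  have sw_nth: "sw xs ! k = xs ! Suc k" "sw xs ! Suc k = xs ! k" if "xs \<in> ?P" for xs
    using split[OF that] by (auto simp: sw_append nth_append)
  have nth_neq: "xs ! k \<noteq> xs ! Suc k" if "xs \<in> ?P" for xs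
    using permutations_of_setD(2)[OF that] len[OF that] k by (simp add: nth_eq_iff_index_eq)
  have P_eq: "?P = Asc \<union> sw ` Asc"
  proof (intro equalityI subsetI)
    fix xs assume xs: "xs \<in> ?P"
    show "xs \<in> Asc \<union> sw ` Asc"
    proof (cases "xs ! k < xs ! Suc k")
      case False
      then have "sw xs \<in> Asc"
        using nth_neq[OF xs] xs by (auto simp: Asc_def sw_P sw_nth)
      with sw_sw[OF xs] show ?thesis by (metis UnI2 imageI)
    qed (use xs in \<open>simp add: Asc_def\<close>)
  qed (auto simp: Asc_def sw_P)
  have fin: "finite Asc" by (simp add: Asc_def)
  have disj: "Asc \<inter> sw ` Asc = {}"
    by (auto simp: Asc_def sw_nth)
  have inj: "inj_on sw Asc"
    by (rule inj_on_inverseI[where g = sw]) (simp add: Asc_def sw_sw)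
  have "(\<Sum>xs\<in>?P. (q ^ list_inversions xs) *s h xs)
      = (\<Sum>xs\<in>Asc. (q ^ list_inversions xs) *s h xs
          + (q ^ list_inversions (sw xs)) *s h (sw xs))"
    unfolding P_eq using fin disj inj
    by (simp add: sum.union_disjoint sum.reindex sum.distrib)
  also have "\<dots> \<in> S"
  proof (rule subspace_sum[OF S])
    fix xs assume xs: "xs \<in> Asc"
    then obtain ps a b qs where xs_eq: "xs = ps @ a # b # qs" and ps: "length ps = k"
      using split[of xs] by (fastforce simp: Asc_def)
    then have ab: "a < b" using xs by (simp add: Asc_def nth_append)
    have "list_inversions (sw xs) = Suc (list_inversions xs)"
      unfolding xs_eq sw_append[OF ps]
      using xs ab by (intro list_inversions_swap) (auto simp: Asc_def xs_eq permutations_of_set_def)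
    then have "(q ^ list_inversions xs) *s h xs + (q ^ list_inversions (sw xs)) *s h (sw xs)
        = (q ^ list_inversions xs) *s (h xs + q *s h (sw xs))"
      by (simp add: scale_right_distrib mult.commute)
    moreover have "h xs + q *s h (sw xs) \<in> S"
      unfolding xs_eq sw_append[OF ps]
      using xs ab ps by (intro pair) (auto simp: Asc_def xs_eq)
    ultimately show "(q ^ list_inversions xs) *s h xs
        + (q ^ list_inversions (sw xs)) *s h (sw xs) \<in> S"
      using subspace_scale[OF S] by simp
  qed
  finally show ?thesis .
qed

text \<open>
  The words \<open>xs\<close> and \<open>ys\<close> are thought of as the two lists of indices of a monomial in the generators.
  The hypothesis says that an ascent in \<open>ys\<close> can be turned into a descent at the cost of a factor \<open>q\<close>,
  once the two words exchanged at that place have been combined. Sorting \<open>ys\<close> by exchanges of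
  neighbours, one inversion at a time, then gives the total factor.
\<close>

lemma q_alternating_sum_congruent:
  fixes W :: "'i::linorder list \<Rightarrow> 'i list \<Rightarrow> 'b"
  assumes S: "subspace S" and A: "finite A"
    and pair: "\<And>ps a b qs us c d vs. \<lbrakk>length ps = length us; length qs = length vs; a < b; c < d;
        ps @ a # b # qs \<in> permutations_of_set A; us @ c # d # vs \<in> permutations_of_set A\<rbrakk>
      \<Longrightarrow> W (ps @ a # b # qs) (us @ d # c # vs) + q *s W (ps @ b # a # qs) (us @ d # c # vs)
        - q *s (W (ps @ a # b # qs) (us @ c # d # vs) + q *s W (ps @ b # a # qs) (us @ c # d # vs)) \<in> S"
    and ys: "ys \<in> permutations_of_set A"
  shows "(\<Sum>xs\<in>permutations_of_set A. (q ^ list_inversions xs) *s W xs ys)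
    - (q ^ list_inversions ys) *s
      (\<Sum>xs\<in>permutations_of_set A. (q ^ list_inversions xs) *s W xs (sorted_list_of_set A)) \<in> S"
    (is "?D ys - _ *s ?D ?id \<in> S")
  using ys
proof (induction "list_inversions ys" arbitrary: ys rule: less_induct)
  case less
  have len: "length xs = card A" if "xs \<in> permutations_of_set A" for xs
    using that by (rule length_finite_permutations_of_set)
  show ?case
  proof (cases "sorted ys")
    case True
    then have "ys = ?id"
      using permutations_of_setD[OF less.prems] A by (intro sorted_distinct_set_unique) simp_all
    moreover have "list_inversions xs = 0" if "sorted xs" for xs :: "'i list"
      using that by (induction xs) (auto simp: leD)
    then have "list_inversions ?id = 0" by simp
    ultimately show ?thesis using subspace_0[OF S] by simp
  next
    case False
    obtain us d c vs where ys: "ys = us @ d # c # vs" and cd: "c < d"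
      using not_sorted_descent[OF False] .
    define zs where "zs = us @ c # d # vs"
    have zs: "zs \<in> permutations_of_set A"
      using less.prems by (auto simp: zs_def ys permutations_of_set_def)
    then have inv: "list_inversions ys = Suc (list_inversions zs)"
      unfolding ys zs_def using cd
      by (intro list_inversions_swap) (auto simp: permutations_of_set_def)
    \<comment> \<open>One exchange costs one factor \<open>q\<close>: the difference is an alternating sum whose pairs lie in \<open>S\<close>.\<close>
    have "(\<Sum>xs\<in>permutations_of_set A. (q ^ list_inversions xs) *s (W xs ys - q *s W xs zs)) \<in> S"
    proof (rule q_alternating_sum_mem_subspace[OF S])
      show "Suc (length us) < card A"
        using len[OF zs] by (simp add: zs_def)
      fix ps a b qs
      assume ps: "length ps = length us" "a < (b::'i)" and P: "ps @ a # b # qs \<in> permutations_of_set A"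
      then have "length qs = length vs"
        using len[OF P] len[OF zs] by (simp add: zs_def)
      from pair[OF ps(1) this ps(2) cd P] zs
      show "W (ps @ a # b # qs) ys - q *s W (ps @ a # b # qs) zs
          + q *s (W (ps @ b # a # qs) ys - q *s W (ps @ b # a # qs) zs) \<in> S"
        by (simp add: ys zs_def algebra_simps)
    qed
    also have "(\<Sum>xs\<in>permutations_of_set A. (q ^ list_inversions xs) *s (W xs ys - q *s W xs zs))
        = ?D ys - q *s ?D zs"
      by (simp add: scale_right_diff_distrib sum_subtractf scale_sum_right mult.commute)
    finally have step: "?D ys - q *s ?D zs \<in> S" .
    have "?D zs - (q ^ list_inversions zs) *s ?D ?id \<in> S"
      using less.hyps[OF _ zs] inv by simp
    from subspace_add[OF S step subspace_scale[OF S this, of q]]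
    show ?thesis by (simp add: inv scale_right_diff_distrib)
  qed
qed

text \<open>
  Modulo \<open>S\<close>, the sums over \<open>xs\<close> are all multiples of the one for the sorted word. Hence in the double sum the
  summation over \<open>ys\<close> only acts on scalars and produces the factor that \<open>c\<close> is assumed to cancel.
\<close>

lemma q_determinant_congruent:
  fixes W :: "'i::linorder list \<Rightarrow> 'i list \<Rightarrow> 'b"
  assumes S: "subspace S" and A: "finite A"
    and pair: "\<And>ps a b qs us c d vs. \<lbrakk>length ps = length us; length qs = length vs; a < b; c < d;
        ps @ a # b # qs \<in> permutations_of_set A; us @ c # d # vs \<in> permutations_of_set A\<rbrakk>
      \<Longrightarrow> W (ps @ a # b # qs) (us @ d # c # vs) + q *s W (ps @ b # a # qs) (us @ d # c # vs)
        - q *s (W (ps @ a # b # qs) (us @ c # d # vs) + q *s W (ps @ b # a # qs) (us @ c # d # vs)) \<in> S"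
    and q: "q \<noteq> 0"
    and norm: "c * (\<Sum>ys\<in>permutations_of_set A. (q * q') ^ list_inversions ys) = 1"
    and zs: "zs \<in> permutations_of_set A"
  shows "c *s (\<Sum>ys\<in>permutations_of_set A. \<Sum>xs\<in>permutations_of_set A.
        (q ^ list_inversions xs * q' ^ list_inversions ys) *s W xs ys)
      - inverse (q ^ list_inversions zs) *s
        (\<Sum>xs\<in>permutations_of_set A. (q ^ list_inversions xs) *s W xs zs) \<in> S"
    (is "?L - _ *s ?D zs \<in> S")
proof -
  let ?P = "permutations_of_set A"
  let ?id = "sorted_list_of_set A"
  have D: "?D ys - (q ^ list_inversions ys) *s ?D ?id \<in> S" if "ys \<in> ?P" for ys
    by (rule q_alternating_sum_congruent[OF S A _ that]) (rule pair)
  have "c *s (\<Sum>ys\<in>?P. (q' ^ list_inversions ys) *s (?D ys - (q ^ list_inversions ys) *s ?D ?id)) \<in> S"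
    by (intro subspace_scale[OF S] subspace_sum[OF S] D)
  also have "(\<Sum>ys\<in>?P. (q' ^ list_inversions ys) *s (?D ys - (q ^ list_inversions ys) *s d))
      = (\<Sum>ys\<in>?P. (q' ^ list_inversions ys) *s ?D ys)
        - (\<Sum>ys\<in>?P. (q * q') ^ list_inversions ys) *s d" for d
    by (simp add: scale_right_diff_distrib sum_subtractf scale_sum_left power_mult_distrib mult.commute)
  also have "(\<Sum>ys\<in>?P. (q' ^ list_inversions ys) *s ?D ys)
      = (\<Sum>ys\<in>?P. \<Sum>xs\<in>?P. (q ^ list_inversions xs * q' ^ list_inversions ys) *s W xs ys)"
    by (simp add: scale_sum_right mult.commute)
  also have "c *s (\<dots> - (\<Sum>ys\<in>?P. (q * q') ^ list_inversions ys) *s ?D ?id)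
      = ?L - (c * (\<Sum>ys\<in>?P. (q * q') ^ list_inversions ys)) *s ?D ?id"
    by (simp only: scale_right_diff_distrib scale_scale)
  finally have L: "?L - ?D ?id \<in> S" using norm by simp
  have "inverse (q ^ list_inversions zs) *s (?D zs - (q ^ list_inversions zs) *s ?D ?id) \<in> S"
    by (intro subspace_scale[OF S] D zs)
  then have "inverse (q ^ list_inversions zs) *s ?D zs - ?D ?id \<in> S"
    using q by (simp add: scale_right_diff_distrib)
  from subspace_diff[OF S L this] show ?thesis by simp
qed

text \<open>
  Here \<open>x, y, z, w\<close> stand for \<open>t\<^bsub>ad\<^esub> t\<^bsub>bc\<^esub>\<close>, \<open>t\<^bsub>bc\<^esub> t\<^bsub>ad\<^esub>\<close>, \<open>t\<^bsub>ac\<^esub> t\<^bsub>bd\<^esub>\<close>, \<open>t\<^bsub>bd\<^esub> t\<^bsub>ac\<^esub>\<close> with \<open>a < b\<close> and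
  \<open>c < d\<close>, and \<open>q\<close> stands for \<open>s\<close>. The next lemma is the same for the exchange of rows, in which \<open>x\<close>
  and \<open>y\<close> trade their places because the roles of the two indices are reversed.
\<close>

lemma column_exchange:
  assumes S: "subspace S" and "x - (r * q) *s y \<in> S" and "z - w - (q - r) *s y \<in> S"
  shows "x + (- q) *s w - (- q) *s (z + (- q) *s y) \<in> S"
proof -
  have eq: "x + (- q) *s w - (- q) *s (z + (- q) *s y)
      = (x - (r * q) *s y) + q *s (z - w - (q - r) *s y)"
    by (simp add: algebra_simps scale_left_diff_distrib)
  show ?thesis
    unfolding eq by (intro subspace_add[OF S] subspace_scale[OF S] assms(2,3))
qed

lemma row_exchange:
  assumes S: "subspace S" and r: "r \<noteq> 0"
    and "x - (r * q) *s y \<in> S" and "z - w - (q - r) *s y \<in> S"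
  shows "y + inverse (- r) *s w - inverse (- r) *s (z + inverse (- r) *s x) \<in> S"
proof -
  have eq: "y + inverse (- r) *s w - inverse (- r) *s (z + inverse (- r) *s x)
      = - (inverse r * inverse r) *s (x - (r * q) *s y) + inverse r *s (z - w - (q - r) *s y)"
    using r by (simp add: algebra_simps scale_left_diff_distrib)
  show ?thesis
    unfolding eq by (intro subspace_add[OF S] subspace_scale[OF S] assms(3,4))
qed

end

section \<open>Free algebras and their quotients\<close>

abbreviation scalar :: "'b::zero \<Rightarrow> 'a::monoid_add \<Rightarrow>\<^sub>0 'b" where
  "scalar \<equiv> Poly_Mapping.single 0"

lemma free_algebra_sel [simp]:
  "mult (free_algebra X) = (*)" "\<one>\<^bsub>free_algebra X\<^esub> = 1"
  "\<zero>\<^bsub>free_algebra X\<^esub> = 0" "add (free_algebra X) = (+)"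
  "smult (free_algebra X) c p = scalar c * p"
  by (simp_all add: free_algebra_def)

lemma scalar_mem_free_algebra: "scalar c \<in> carrier (free_algebra X)"
  by (simp add: free_algebra_def zero_word_def)

lemma free_gen_mem: "g \<in> X \<Longrightarrow> free_gen g \<in> carrier (free_algebra X)"
  by (simp add: free_algebra_def free_gen_def)

lemma free_algebra_closed:
  assumes "p \<in> carrier (free_algebra X)" "q \<in> carrier (free_algebra X)"
  shows "p + q \<in> carrier (free_algebra X)" "p * q \<in> carrier (free_algebra X)"
    "- p \<in> carrier (free_algebra X)"
proof -
  interpret ring "free_algebra X" by (rule ring_free_algebra)
  show "p + q \<in> carrier (free_algebra X)" "p * q \<in> carrier (free_algebra X)"
    using a_closed[OF assms] m_closed[OF assms] by simp_all
  show "- p \<in> carrier (free_algebra X)"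
    using assms by (simp add: free_algebra_def in_keys_iff)
qed

lemma a_minus_free_algebra:
  assumes "p \<in> carrier (free_algebra X)" "q \<in> carrier (free_algebra X)"
  shows "p \<ominus>\<^bsub>free_algebra X\<^esub> q = p - q"
proof -
  interpret ring "free_algebra X" by (rule ring_free_algebra)
  have "\<ominus>\<^bsub>free_algebra X\<^esub> q = - q"
    using assms free_algebra_closed by (intro minus_equality) auto
  then show ?thesis by (simp add: a_minus_def)
qed

lemma finsum_free_algebra:
  assumes "\<And>i. i \<in> S \<Longrightarrow> f i \<in> carrier (free_algebra X)"
  shows "finsum (free_algebra X) f S = sum f S"
proof -
  interpret ring "free_algebra X" by (rule ring_free_algebra)
  show ?thesis using assms
    by (induction S rule: infinite_finite_induct) (auto simp: Pi_def finsum_infinite)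
qed

lemma finsum_free_algebra_eq:
  assumes "\<And>i. i \<in> S \<Longrightarrow> f i = g i" and "\<And>i. i \<in> S \<Longrightarrow> g i \<in> carrier (free_algebra X)"
  shows "finsum (free_algebra X) f S = sum g S"
  using assms by (simp add: finsum_free_algebra cong: sum.cong)

text \<open>
  Although the words do not commute, the empty word is neutral on both sides, so that constants are
  central.
\<close>

lemma scalar_commute: "scalar c * p = p * scalar c"
  for p :: "'a::monoid_add \<Rightarrow>\<^sub>0 'b::comm_semiring_1"
proof (induction p rule: update_induct)
  case (update p a b)
  then have "Poly_Mapping.update a b p = Poly_Mapping.single a b + p"
    by (intro poly_mapping_eqI)
      (auto simp: lookup_add lookup_update lookup_single when_def in_keys_iff)
  with update show ?case by (simp add: distrib_left distrib_right mult_single mult.commute)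
qed simp

lemma scalar_left_commute:
  "p * (scalar c * q) = scalar c * (p * q)"
  for p q :: "'a::monoid_add \<Rightarrow>\<^sub>0 'b::comm_semiring_1"
  by (simp only: mult.assoc[symmetric] scalar_commute[of c p])

lemma single_if_add_mult:
  "scalar ((if P then x else 0) + (if Q then y else 0)) * p
    = (if P then scalar x * p else 0) + (if Q then scalar y * p else 0)"
  for p :: "'a::monoid_add \<Rightarrow>\<^sub>0 'b::semiring_1"
  by (cases P; cases Q) (simp_all add: single_add distrib_right)

interpretation free: vector_space "\<lambda>c p :: 'g word \<Rightarrow>\<^sub>0 complex. scalar c * p"
  by standard (simp_all add: distrib_left distrib_right single_add mult.assoc[symmetric] mult_single)

lemma ideal_subspace:
  assumes "ideal I (free_algebra X)"
  shows "free.subspace I"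
proof -
  interpret ideal I "free_algebra X" by fact
  show ?thesis
    unfolding free.subspace_def
    using additive_subgroup.zero_closed[OF is_additive_subgroup]
      additive_subgroup.a_closed[OF is_additive_subgroup] I_l_closed[OF _ scalar_mem_free_algebra]
    by simp
qed

text \<open>
  Homomorphisms of complex algebras. They are applied to the projection of the free algebra onto a
  quotient; the identity serves to obtain closure properties of operators on the free algebra.
\<close>

locale calg_hom = ring_hom_ring A B h
  for A :: "'a calg" and B :: "'b calg" and h +
  assumes smult_closed: "x \<in> carrier A \<Longrightarrow> c \<odot>\<^bsub>A\<^esub> x \<in> carrier A"
    and hom_smult: "x \<in> carrier A \<Longrightarrow> h (c \<odot>\<^bsub>A\<^esub> x) = c \<odot>\<^bsub>B\<^esub> h x"
begin

lemma hom_finsum_eq: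
  assumes "\<And>i. i \<in> S \<Longrightarrow> f i \<in> carrier A" and "\<And>i. i \<in> S \<Longrightarrow> h (f i) = g i"
  shows "h (finsum A f S) = finsum B g S"
  using assms
proof (induction S rule: infinite_finite_induct)
  case (insert i S)
  have fg: "f j \<in> carrier A" "g j \<in> carrier B" if "j \<in> insert i S" for j
    using insert.prems(1)[OF that] insert.prems(2)[OF that, symmetric] by simp_all
  then have "f \<in> S \<rightarrow> carrier A" "f i \<in> carrier A" "g \<in> S \<rightarrow> carrier B" "g i \<in> carrier B"
    by auto
  with insert show ?case by simp
qed (simp_all add: R.finsum_infinite S.finsum_infinite)

lemma leg_op_closed:
  assumes "\<And>i j. i \<in> {1..n} \<Longrightarrow> j \<in> {1..n} \<Longrightarrow> t i j \<in> carrier A"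
  shows "leg_op A n m t k I J \<in> carrier A"
  unfolding leg_op_def using assms by (intro R.finsum_closed Pi_I smult_closed) auto

lemma hom_leg_op:
  assumes "\<And>i j. i \<in> {1..n} \<Longrightarrow> j \<in> {1..n} \<Longrightarrow> t i j \<in> carrier A"
  shows "h (leg_op A n m t k I J) = leg_op B n m (\<lambda>i j. h (t i j)) k I J"
  unfolding leg_op_def using assms
  by (intro hom_finsum_eq hom_smult R.finsum_closed Pi_I smult_closed) auto

lemma op_one_closed: "op_one A m I J \<in> carrier A"
  by (simp add: op_one_def scalar_op_def smult_closed)

lemma hom_op_one: "h (op_one A m I J) = op_one B m I J"
  by (simp add: op_one_def scalar_op_def hom_smult)

lemma op_mult_closed:
  assumes "\<And>K. K \<in> multi_indices n m \<Longrightarrow> M I K \<in> carrier A"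
    and "\<And>K. K \<in> multi_indices n m \<Longrightarrow> N K J \<in> carrier A"
  shows "op_mult A n m M N I J \<in> carrier A"
  unfolding op_mult_def using assms by (intro R.finsum_closed) auto

lemma hom_op_mult:
  assumes "\<And>K. K \<in> multi_indices n m \<Longrightarrow> M I K \<in> carrier A"
    and "\<And>K. K \<in> multi_indices n m \<Longrightarrow> N K J \<in> carrier A"
    and "\<And>K. K \<in> multi_indices n m \<Longrightarrow> h (M I K) = M' I K"
    and "\<And>K. K \<in> multi_indices n m \<Longrightarrow> h (N K J) = N' K J"
  shows "h (op_mult A n m M N I J) = op_mult B n m M' N' I J"
  unfolding op_mult_def using assms by (intro hom_finsum_eq) auto

lemma legs_closed:
  assumes "\<And>i j. i \<in> {1..n} \<Longrightarrow> j \<in> {1..n} \<Longrightarrow> t i j \<in> carrier A"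
  shows "foldr (op_mult A n m) (map (leg_op A n m t) ks) (op_one A m) I J \<in> carrier A"
proof (induction ks arbitrary: I J)
  case (Cons k ks)
  show ?case
    using assms by (auto intro!: op_mult_closed leg_op_closed Cons.IH)
qed (simp add: op_one_closed)

lemma hom_legs:
  assumes "\<And>i j. i \<in> {1..n} \<Longrightarrow> j \<in> {1..n} \<Longrightarrow> t i j \<in> carrier A"
  shows "h (foldr (op_mult A n m) (map (leg_op A n m t) ks) (op_one A m) I J)
    = foldr (op_mult B n m) (map (leg_op B n m (\<lambda>i j. h (t i j))) ks) (op_one B m) I J"
proof (induction ks arbitrary: I J)
  case (Cons k ks)
  show ?case
    using assms
    by (auto intro!: hom_op_mult Cons.IH leg_op_closed legs_closed hom_leg_op)
qed (simp add: hom_op_one)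

lemma ordered_prod_closed:
  assumes "\<And>k. k \<in> {1..n} \<Longrightarrow> x k \<in> carrier A"
  shows "ordered_prod A n x \<in> carrier A"
proof -
  have "foldr (\<otimes>\<^bsub>A\<^esub>) (map x ks) \<one>\<^bsub>A\<^esub> \<in> carrier A" if "set ks \<subseteq> {1..n}" for ks
    using that assms by (induction ks) auto
  from this[of "[1..<n+1]"] show ?thesis
    unfolding ordered_prod_def by (simp add: atLeastLessThanSuc_atLeastAtMost del: upt_Suc)
qed

lemma hom_ordered_prod:
  assumes "\<And>k. k \<in> {1..n} \<Longrightarrow> x k \<in> carrier A"
  shows "h (ordered_prod A n x) = ordered_prod B n (\<lambda>k. h (x k))"
proof -
  have "foldr (\<otimes>\<^bsub>A\<^esub>) (map x ks) \<one>\<^bsub>A\<^esub> \<in> carrier A \<and>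
    h (foldr (\<otimes>\<^bsub>A\<^esub>) (map x ks) \<one>\<^bsub>A\<^esub>) = foldr (\<otimes>\<^bsub>B\<^esub>) (map (\<lambda>k. h (x k)) ks) \<one>\<^bsub>B\<^esub>"
    if "set ks \<subseteq> {1..n}" for ks
    using that assms by (induction ks) auto
  from this[of "[1..<n+1]"] show ?thesis
    unfolding ordered_prod_def by (simp add: atLeastLessThanSuc_atLeastAtMost del: upt_Suc)
qed

lemma hom_weighted_ordered_prods:
  assumes "\<And>\<sigma> k. \<sigma> \<in> S \<Longrightarrow> k \<in> {1..n} \<Longrightarrow> x \<sigma> k \<in> carrier A"
  shows "h (\<Oplus>\<^bsub>A\<^esub>\<sigma>\<in>S. c \<sigma> \<odot>\<^bsub>A\<^esub> ordered_prod A n (x \<sigma>))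
      = (\<Oplus>\<^bsub>B\<^esub>\<sigma>\<in>S. c \<sigma> \<odot>\<^bsub>B\<^esub> ordered_prod B n (\<lambda>k. h (x \<sigma> k)))"
proof (rule hom_finsum_eq)
  fix \<sigma> assume "\<sigma> \<in> S"
  then have prod: "ordered_prod A n (x \<sigma>) \<in> carrier A"
    by (intro ordered_prod_closed assms)
  then show "c \<sigma> \<odot>\<^bsub>A\<^esub> ordered_prod A n (x \<sigma>) \<in> carrier A" by (rule smult_closed)
  show "h (c \<sigma> \<odot>\<^bsub>A\<^esub> ordered_prod A n (x \<sigma>)) = c \<sigma> \<odot>\<^bsub>B\<^esub> ordered_prod B n (\<lambda>k. h (x \<sigma> k))"
    unfolding hom_smult[OF prod] using \<open>\<sigma> \<in> S\<close> by (subst hom_ordered_prod) (simp_all add: assms)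
qed

end

lemma calg_hom_id: "calg_hom (free_algebra X) (free_algebra X) id"
proof (intro calg_hom.intro calg_hom_axioms.intro ring_hom_ringI2 ring_free_algebra)
  show "id \<in> ring_hom (free_algebra X) (free_algebra X)"
    by (rule ring_hom_memI) simp_all
qed (simp_all add: free_algebra_closed scalar_mem_free_algebra)

text \<open>
  The scalar multiplication of the quotient is a union over all representatives of a coset. It
  collapses to the coset of a single one because constants lie in the algebra, so that multiplying by
  them preserves the ideal.
\<close>

lemma calg_hom_quotient:
  assumes "ideal I (free_algebra X)"
  shows "calg_hom (free_algebra X) (quotient_algebra (free_algebra X) I)
    ((+>\<^bsub>free_algebra X\<^esub>) I)"
proof -
  let ?A = "free_algebra X"
  let ?Q = "quotient_algebra ?A I"
  interpret ideal I ?A by fact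
  have Q: "carrier ?Q = carrier (?A Quot I)" "mult ?Q = mult (?A Quot I)"
    "\<one>\<^bsub>?Q\<^esub> = \<one>\<^bsub>?A Quot I\<^esub>" "\<zero>\<^bsub>?Q\<^esub> = \<zero>\<^bsub>?A Quot I\<^esub>" "add ?Q = add (?A Quot I)"
    "smult ?Q = (\<lambda>c X. \<Union>x\<in>X. I +>\<^bsub>?A\<^esub> (c \<odot>\<^bsub>?A\<^esub> x))"
    by (simp_all add: quotient_algebra_def ring.defs module.defs)
  have hom: "(+>\<^bsub>?A\<^esub>) I \<in> ring_hom ?A ?Q"
    using rcos_ring_hom by (simp add: ring_hom_def Q)
  interpret Q: ring "?A Quot I" by (rule quotient_is_ring)
  have "ring ?Q"
  proof (rule ringI)
    show "abelian_group ?Q"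
    proof (rule abelian_groupI)
      show "\<exists>y\<in>carrier ?Q. y \<oplus>\<^bsub>?Q\<^esub> x = \<zero>\<^bsub>?Q\<^esub>" if "x \<in> carrier ?Q" for x
        using that Q.l_neg[of x] Q.a_inv_closed[of x] by (auto simp only: Q)
    qed (simp_all only: Q Q.a_closed Q.zero_closed Q.a_ac Q.l_zero Q.r_zero)
    show "monoid ?Q"
      by (rule monoidI) (simp_all only: Q Q.m_closed Q.one_closed Q.m_assoc Q.l_one Q.r_one)
  qed (simp_all only: Q Q.l_distr Q.r_distr)
  then show ?thesis
  proof (intro calg_hom.intro ring_hom_ringI2 calg_hom_axioms.intro ring_axioms hom)
    fix p and c :: complex assume p: "p \<in> carrier ?A"
    let ?c = "scalar c"
    show cp: "c \<odot>\<^bsub>?A\<^esub> p \<in> carrier ?A"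
      using m_closed[OF scalar_mem_free_algebra p, of c] by simp
    have "I +>\<^bsub>?A\<^esub> ?c * x = I +>\<^bsub>?A\<^esub> ?c * p" if coset: "x \<in> I +>\<^bsub>?A\<^esub> p" for x
    proof -
      obtain i where i: "i \<in> I" and x: "x = i + p"
        using coset by (auto simp: a_r_coset_def')
      have "?c * i \<in> I" using I_l_closed[OF i scalar_mem_free_algebra] by simp
      then have "?c * x \<in> I +>\<^bsub>?A\<^esub> ?c * p"
        by (auto simp: a_r_coset_def' x distrib_left)
      from a_repr_independence'[OF this] cp show ?thesis by simp
    qed
    moreover have "p \<in> I +>\<^bsub>?A\<^esub> p" using p by (rule a_rcos_self)
    ultimately have "(\<Union>x\<in>I +>\<^bsub>?A\<^esub> p. I +>\<^bsub>?A\<^esub> ?c * x) = I +>\<^bsub>?A\<^esub> ?c * p"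
      by blast
    then show "I +>\<^bsub>?A\<^esub> (c \<odot>\<^bsub>?A\<^esub> p) = c \<odot>\<^bsub>?Q\<^esub> (I +>\<^bsub>?A\<^esub> p)"
      by (simp only: Q free_algebra_sel)
  qed
qed

lemma coset_eqI:
  assumes "ideal I (free_algebra X)" "p \<in> carrier (free_algebra X)" "q \<in> carrier (free_algebra X)"
    and "p - q \<in> I"
  shows "I +>\<^bsub>free_algebra X\<^esub> p = I +>\<^bsub>free_algebra X\<^esub> q"
proof -
  interpret ideal I "free_algebra X" by fact
  have "p = (p - q) + q" by simp
  with assms(4) have "p \<in> I +>\<^bsub>free_algebra X\<^esub> q"
    unfolding a_r_coset_def' by (auto intro!: bexI[of _ "p - q"])
  from a_repr_independence'[OF this] assms(3) show ?thesis by simp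
qed

section \<open>Leg operators and the R-matrix\<close>

lemma prod_of_bool:
  "finite S \<Longrightarrow> (\<Prod>p\<in>S. of_bool (P p)) = (of_bool (\<forall>p\<in>S. P p) :: 'a::comm_semiring_1)"
  by (induction S rule: finite_induct) auto

lemma tensor_mat_id:
  assumes "length I = m" "length J = m"
  shows "tensor_mat (replicate m id_mat) I J = of_bool (I = J)"
proof -
  have "tensor_mat (replicate m id_mat) I J = (\<Prod>p<m. of_bool (I ! p = J ! p))"
    unfolding tensor_mat_def by (rule prod.cong) (simp_all add: id_mat_def)
  also have "\<dots> = of_bool (I = J)"
    using assms by (auto simp: prod_of_bool list_eq_iff_nth_eq)
  finally show ?thesis .
qed

text \<open>
  Legs are numbered from 1 but lists are indexed from 0: the unit matrix stands in leg \<open>Suc k\<close>.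
\<close>

lemma tensor_mat_leg:
  assumes "k < m" "length I = m" "length J = m"
  shows "tensor_mat (replicate k id_mat @ [unit_mat i j] @ replicate (m - Suc k) id_mat) I J
    = of_bool (i = I ! k \<and> J = I[k := j])"
proof -
  have "tensor_mat (replicate k id_mat @ [unit_mat i j] @ replicate (m - Suc k) id_mat) I J
      = (\<Prod>p<m. of_bool (if p = k then i = I ! k \<and> J ! k = j else I ! p = J ! p))"
    unfolding tensor_mat_def
    by (rule prod.cong) (use assms in \<open>auto simp: nth_append id_mat_def unit_mat_def nth_Cons'\<close>)
  also have "\<dots> = of_bool (\<forall>p<m. if p = k then i = I ! k \<and> J ! k = j else I ! p = J ! p)"
    by (simp only: prod_of_bool[OF finite_lessThan] Ball_def lessThan_iff)
  also have "(\<forall>p<m. if p = k then i = I ! k \<and> J ! k = j else I ! p = J ! p)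
      \<longleftrightarrow> i = I ! k \<and> J = I[k := j]"
    using assms by (auto simp: list_eq_iff_nth_eq nth_list_update)
  finally show ?thesis .
qed

lemma finite_multi_indices: "finite (multi_indices n m)"
  using finite_lists_length_eq[of "{1..n}" m] by (simp add: multi_indices_def conj_commute)

lemma multi_indices_nth: "I \<in> multi_indices n m \<Longrightarrow> k < m \<Longrightarrow> I ! k \<in> {1..n}"
  using nth_mem by (fastforce simp: multi_indices_def)

lemma multi_indices_update:
  "I \<in> multi_indices n m \<Longrightarrow> j \<in> {1..n} \<Longrightarrow> I[k := j] \<in> multi_indices n m"
  using set_update_subset_insert[of I k j] by (auto simp: multi_indices_def)

lemma multi_indices_2E:
  assumes "K \<in> multi_indices n 2"
  obtains c d where "K = [c, d]" "c \<in> {1..n}" "d \<in> {1..n}"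
proof -
  have "length K = Suc (Suc 0)" using assms by (simp add: multi_indices_def)
  then obtain c d where "K = [c, d]" by (auto simp: length_Suc_conv)
  with assms that show thesis by (simp add: multi_indices_def)
qed

lemma pair_in_multi_indices: "c \<in> {1..n} \<Longrightarrow> d \<in> {1..n} \<Longrightarrow> [c, d] \<in> multi_indices n 2"
  by (simp add: multi_indices_def)

context
  fixes X :: "'g set" and t :: "nat \<Rightarrow> nat \<Rightarrow> 'g word \<Rightarrow>\<^sub>0 complex" and n :: nat
  assumes t: "\<And>i j. i \<in> {1..n} \<Longrightarrow> j \<in> {1..n} \<Longrightarrow> t i j \<in> carrier (free_algebra X)"
begin

lemma leg_op_free:
  assumes "k < m" "I \<in> multi_indices n m" "J \<in> multi_indices n m"
  shows "leg_op (free_algebra X) n m t (Suc k) I J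
    = (if J = I[k := J ! k] then t (I ! k) (J ! k) else 0)"
proof -
  let ?M = "\<lambda>i j. tensor_mat (replicate k id_mat @ [unit_mat i j] @ replicate (m - Suc k) id_mat) I J"
  have "length I = m" "length J = m" using assms by (auto simp: multi_indices_def)
  note M = tensor_mat_leg[OF assms(1) this]
  have scaled: "scalar c * t i j \<in> carrier (free_algebra X)"
    if "i \<in> {1..n}" "j \<in> {1..n}" for i j c
    using that by (intro free_algebra_closed scalar_mem_free_algebra t)
  then have row: "(\<Sum>j\<in>{1..n}. scalar (?M i j) * t i j) \<in> carrier (free_algebra X)"
    if "i \<in> {1..n}" for i
  proof -
    interpret ring "free_algebra X" by (rule ring_free_algebra)
    have "finsum (free_algebra X) (\<lambda>j. scalar (?M i j) * t i j) {1..n}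
      \<in> carrier (free_algebra X)"
      using scaled that by (intro finsum_closed) auto
    then show ?thesis using scaled that by (simp only: finsum_free_algebra)
  qed
  have "leg_op (free_algebra X) n m t (Suc k) I J
      = (\<Sum>i\<in>{1..n}. \<Sum>j\<in>{1..n}. scalar (?M i j) * t i j)"
    unfolding leg_op_def using scaled row
    by (intro finsum_free_algebra_eq) (simp_all add: finsum_free_algebra)
  also have "\<dots> = (\<Sum>i\<in>{1..n}. \<Sum>j\<in>{1..n}. if i = I ! k then
      if j = J ! k then if J = I[k := J ! k] then t (I ! k) (J ! k) else 0 else 0 else 0)"
  proof (intro sum.cong refl)
    fix i j
    have "J = I[k := j] \<longleftrightarrow> j = J ! k \<and> J = I[k := J ! k]"
      using assms by (auto simp: multi_indices_def)
    then show "scalar (?M i j) * t i j = (if i = I ! k then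
      if j = J ! k then if J = I[k := J ! k] then t (I ! k) (J ! k) else 0 else 0 else 0)"
      unfolding M by simp
  qed
  also have "\<dots> = (\<Sum>i\<in>{1..n}. if i = I ! k then
      if J = I[k := J ! k] then t (I ! k) (J ! k) else 0 else 0)"
    using multi_indices_nth[OF assms(3,1)] by (intro sum.cong) simp_all
  also have "\<dots> = (if J = I[k := J ! k] then t (I ! k) (J ! k) else 0)"
    using multi_indices_nth[OF assms(2,1)] by simp
  finally show ?thesis .
qed

text \<open>
  An operator on a single leg changes a single index, so that the sum over all multi-indices reduces to
  a sum over that index.
\<close>

lemma op_mult_leg_free:
  assumes k: "k < m" and I: "I \<in> multi_indices n m"
    and N: "\<And>K. K \<in> multi_indices n m \<Longrightarrow> N K J \<in> carrier (free_algebra X)"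
  shows "op_mult (free_algebra X) n m (leg_op (free_algebra X) n m t (Suc k)) N I J
    = (\<Sum>j\<in>{1..n}. t (I ! k) j * N (I[k := j]) J)"
proof -
  have len: "length I = m" using I by (simp add: multi_indices_def)
  have Ik: "I ! k \<in> {1..n}" by (rule multi_indices_nth[OF I k])
  have leg: "leg_op (free_algebra X) n m t (Suc k) I K
      = (if K = I[k := K ! k] then t (I ! k) (K ! k) else 0)" if "K \<in> multi_indices n m" for K
    by (rule leg_op_free[OF k I that])
  have zero: "0 \<in> carrier (free_algebra X)" by (simp add: free_algebra_def)
  have "op_mult (free_algebra X) n m (leg_op (free_algebra X) n m t (Suc k)) N I J
      = (\<Sum>K\<in>multi_indices n m. leg_op (free_algebra X) n m t (Suc k) I K * N K J)"
    unfolding op_mult_def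
  proof (subst finsum_free_algebra)
    fix K assume K: "K \<in> multi_indices n m"
    have "leg_op (free_algebra X) n m t (Suc k) I K \<in> carrier (free_algebra X)"
      using t[OF Ik multi_indices_nth[OF K k]] zero by (simp add: leg[OF K])
    then show "leg_op (free_algebra X) n m t (Suc k) I K \<otimes>\<^bsub>free_algebra X\<^esub> N K J
        \<in> carrier (free_algebra X)"
      using N[OF K] by (simp add: free_algebra_closed)
  qed simp
  also have "\<dots> = (\<Sum>K\<in>(\<lambda>j. I[k := j]) ` {1..n}. t (I ! k) (K ! k) * N K J)"
  proof (rule sum.mono_neutral_cong_right[OF finite_multi_indices])
    show "(\<lambda>j. I[k := j]) ` {1..n} \<subseteq> multi_indices n m"
      using I by (auto intro: multi_indices_update)
    show "\<forall>K\<in>multi_indices n m - (\<lambda>j. I[k := j]) ` {1..n}.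
        leg_op (free_algebra X) n m t (Suc k) I K * N K J = 0"
      using multi_indices_nth[OF _ k] by (auto simp: leg image_iff)
    show "leg_op (free_algebra X) n m t (Suc k) I K * N K J = t (I ! k) (K ! k) * N K J"
      if "K \<in> (\<lambda>j. I[k := j]) ` {1..n}" for K
    proof -
      from that obtain j where K: "K = I[k := j]" and j: "j \<in> {1..n}" by blast
      show ?thesis
        using leg[OF multi_indices_update[OF I j]] k len by (simp add: K)
    qed
  qed
  also have "\<dots> = (\<Sum>j\<in>{1..n}. t (I ! k) j * N (I[k := j]) J)"
  proof (subst sum.reindex)
    show "inj_on (\<lambda>j. I[k := j]) {1..n}"
      using k len by (auto intro!: inj_onI dest: arg_cong[of _ _ "\<lambda>K. K ! k"])
  qed (use k len in simp)
  finally show ?thesis .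
qed

lemma legs_mem_free:
  "foldr (op_mult (free_algebra X) n m) (map (leg_op (free_algebra X) n m t) ks)
    (op_one (free_algebra X) m) I J \<in> carrier (free_algebra X)"
proof -
  interpret calg_hom "free_algebra X" "free_algebra X" id by (rule calg_hom_id)
  show ?thesis using t by (rule legs_closed)
qed

text \<open>
  The operators on the last \<open>m - k\<close> legs do not move the first \<open>k\<close> indices, and each of these
  operators contributes one generator. For \<open>k = 0\<close> this describes \<open>T\<^sub>1 \<cdots> T\<^sub>m\<close> completely.
\<close>

lemma legs_free:
  assumes "k \<le> m" "I \<in> multi_indices n m" "J \<in> multi_indices n m"
  shows "foldr (op_mult (free_algebra X) n m) (map (leg_op (free_algebra X) n m t) [Suc k..<m+1])
      (op_one (free_algebra X) m) I J
    = (if take k I = take k J then prod_list (map2 t (drop k I) (drop k J)) else 0)"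
  using assms
proof (induction k arbitrary: I rule: inc_induct)
  case base
  then have "length I = m" "length J = m" by (auto simp: multi_indices_def)
  then show ?case by (simp add: op_one_def scalar_op_def tensor_mat_id)
next
  case (step k)
  let ?N = "foldr (op_mult (free_algebra X) n m)
    (map (leg_op (free_algebra X) n m t) [Suc (Suc k)..<m+1]) (op_one (free_algebra X) m)"
  have len: "length I = m" "length J = m" using step.prems by (auto simp: multi_indices_def)
  have "[Suc k..<m+1] = Suc k # [Suc (Suc k)..<m+1]"
    using step.hyps by (simp add: upt_conv_Cons del: upt_Suc)
  then have "foldr (op_mult (free_algebra X) n m) (map (leg_op (free_algebra X) n m t) [Suc k..<m+1])
      (op_one (free_algebra X) m) I J
      = op_mult (free_algebra X) n m (leg_op (free_algebra X) n m t (Suc k)) ?N I J"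
    by (simp del: upt_Suc)
  also have "\<dots> = (\<Sum>j\<in>{1..n}. t (I ! k) j * ?N (I[k := j]) J)"
    using step.hyps step.prems by (intro op_mult_leg_free legs_mem_free) auto
  also have "\<dots> = (\<Sum>j\<in>{1..n}. if j = J ! k then if take k I = take k J
      then t (I ! k) j * prod_list (map2 t (drop (Suc k) I) (drop (Suc k) J)) else 0 else 0)"
  proof (rule sum.cong[OF refl])
    fix j assume j: "j \<in> {1..n}"
    have "take (Suc k) (I[k := j]) = take (Suc k) J \<longleftrightarrow> take k I = take k J \<and> j = J ! k"
      using len step.hyps by (simp add: take_Suc_conv_app_nth)
    then show "t (I ! k) j * ?N (I[k := j]) J = (if j = J ! k then if take k I = take k J
      then t (I ! k) j * prod_list (map2 t (drop (Suc k) I) (drop (Suc k) J)) else 0 else 0)"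
      using step.IH[OF multi_indices_update[OF step.prems(1) j] step.prems(2)]
      by (simp del: upt_Suc)
  qed
  also have "\<dots> = (if take k I = take k J
      then t (I ! k) (J ! k) * prod_list (map2 t (drop (Suc k) I) (drop (Suc k) J)) else 0)"
    using multi_indices_nth[OF step.prems(2) step.hyps(2)] by simp
  also have "\<dots> = (if take k I = take k J then prod_list (map2 t (drop k I) (drop k J)) else 0)"
    using len step.hyps by (simp add: Cons_nth_drop_Suc[symmetric])
  finally show ?case .
qed

lemma two_leg_entries:
  assumes "a \<in> {1..n}" "b \<in> {1..n}" "c \<in> {1..n}" "d \<in> {1..n}"
  shows "leg_op (free_algebra X) n 2 t 1 [a, b] [c, d] = (if d = b then t a c else 0)"
    and "leg_op (free_algebra X) n 2 t 2 [a, b] [c, d] = (if c = a then t b d else 0)"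
proof -
  note mem = pair_in_multi_indices[OF assms(1,2)] pair_in_multi_indices[OF assms(3,4)]
  show "leg_op (free_algebra X) n 2 t 1 [a, b] [c, d] = (if d = b then t a c else 0)"
    using leg_op_free[where k = 0, OF _ mem] by simp
  show "leg_op (free_algebra X) n 2 t 2 [a, b] [c, d] = (if c = a then t b d else 0)"
  proof -
    have "leg_op (free_algebra X) n 2 t (Suc 1) [a, b] [c, d]
        = (if [c, d] = [a, b][1 := [c, d] ! 1] then t ([a, b] ! 1) ([c, d] ! 1) else 0)"
      by (rule leg_op_free[where k = 1, OF _ mem]) simp_all
    moreover have "[a, b] ! 1 = b" "[c, d] ! 1 = d" "[a, b][1 := d] = [a, d]" by simp_all
    ultimately show ?thesis by (simp only: Suc_1 list.inject simp_thms)
  qed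
qed

lemma two_leg_closed:
  assumes "K \<in> multi_indices n 2" "c \<in> {1..n}" "d \<in> {1..n}"
  shows "leg_op (free_algebra X) n 2 t 1 K [c, d] \<in> carrier (free_algebra X)"
    and "leg_op (free_algebra X) n 2 t 2 K [c, d] \<in> carrier (free_algebra X)"
proof -
  obtain a b where K: "K = [a, b]" and ab: "a \<in> {1..n}" "b \<in> {1..n}"
    using assms(1) by (rule multi_indices_2E)
  have "0 \<in> carrier (free_algebra X)" by (simp add: free_algebra_def)
  with t[OF ab(1) assms(2)] t[OF ab(2) assms(3)]
  show "leg_op (free_algebra X) n 2 t 1 K [c, d] \<in> carrier (free_algebra X)"
    and "leg_op (free_algebra X) n 2 t 2 K [c, d] \<in> carrier (free_algebra X)"
    unfolding K two_leg_entries[OF ab assms(2,3)] by simp_all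
qed

text \<open>
  The same two generators appear in both products, in opposite order. The relation
  \<open>R T\<^sub>1 T\<^sub>2 = T\<^sub>2 T\<^sub>1 R\<close> thus describes how generators are exchanged.
\<close>

lemma two_legs:
  assumes "a \<in> {1..n}" "b \<in> {1..n}" "c \<in> {1..n}" "d \<in> {1..n}"
  shows "op_mult (free_algebra X) n 2 (leg_op (free_algebra X) n 2 t 1) (leg_op (free_algebra X) n 2 t 2)
      [a, b] [c, d] = t a c * t b d" (is ?thesis1)
    and "op_mult (free_algebra X) n 2 (leg_op (free_algebra X) n 2 t 2) (leg_op (free_algebra X) n 2 t 1)
      [a, b] [c, d] = t b d * t a c" (is ?thesis2)
proof -
  note mult = op_mult_leg_free[where I = "[a, b]" and J = "[c, d]" and m = 2,
      OF _ pair_in_multi_indices[OF assms(1,2)]]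
  have "op_mult (free_algebra X) n 2 (leg_op (free_algebra X) n 2 t 1)
      (leg_op (free_algebra X) n 2 t 2) [a, b] [c, d]
      = (\<Sum>j\<in>{1..n}. t a j * leg_op (free_algebra X) n 2 t 2 [j, b] [c, d])"
    using mult[where k = 0 and N = "leg_op (free_algebra X) n 2 t 2"]
      two_leg_closed(2)[OF _ assms(3,4)] by simp
  also have "\<dots> = (\<Sum>j\<in>{1..n}. if j = c then t a j * t b d else 0)"
    by (rule sum.cong[OF refl]) (simp only: two_leg_entries[OF _ assms(2-4)], simp)
  finally show ?thesis1 using assms(3) by simp
  have "op_mult (free_algebra X) n 2 (leg_op (free_algebra X) n 2 t 2)
      (leg_op (free_algebra X) n 2 t 1) [a, b] [c, d]
      = (\<Sum>j\<in>{1..n}. t b j * leg_op (free_algebra X) n 2 t 1 [a, j] [c, d])"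
  proof -
    have "op_mult (free_algebra X) n 2 (leg_op (free_algebra X) n 2 t (Suc 1))
        (leg_op (free_algebra X) n 2 t 1) [a, b] [c, d]
        = (\<Sum>j\<in>{1..n}. t ([a, b] ! 1) j * leg_op (free_algebra X) n 2 t 1 ([a, b][1 := j]) [c, d])"
      by (rule mult) (assumption | erule two_leg_closed(1)[OF _ assms(3,4)] | simp)+
    moreover have "[a, b] ! 1 = b" "[a, b][1 := j] = [a, j]" for j by simp_all
    ultimately show ?thesis by (simp only: Suc_1)
  qed
  also have "\<dots> = (\<Sum>j\<in>{1..n}. if j = d then t b j * t a c else 0)"
    by (rule sum.cong[OF refl]) (simp only: two_leg_entries[OF assms(1) _ assms(3,4)], simp)
  finally show ?thesis2 using assms(4) by simp
qed

end

lemma sum_pairs_of_bool: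
  fixes f :: "nat \<Rightarrow> nat \<Rightarrow> complex"
  shows "(\<Sum>(i, j)\<in>{(i, j). i \<in> {1..n} \<and> j \<in> {1..n} \<and> P i j}. of_bool (i = a \<and> j = b) * f i j)
    = (if a \<in> {1..n} \<and> b \<in> {1..n} \<and> P a b then f a b else 0)"
proof -
  let ?S = "{(i, j). i \<in> {1..n} \<and> j \<in> {1..n} \<and> P i j}"
  have "finite ?S" by (rule finite_subset[of _ "{1..n} \<times> {1..n}"]) auto
  moreover have "(\<Sum>(i, j)\<in>?S. of_bool (i = a \<and> j = b) * f i j)
      = (\<Sum>p\<in>?S. if p = (a, b) then f a b else 0)"
    by (rule sum.cong) auto
  ultimately show ?thesis by (auto simp: sum.delta)
qed

text \<open>
  The coefficient of \<open>e\<^bsub>aa\<^esub> \<otimes> e\<^bsub>bb\<^esub>\<close> in \<open>R\<close>.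
\<close>

definition R_diag :: "complex \<Rightarrow> complex \<Rightarrow> nat \<Rightarrow> nat \<Rightarrow> complex" where
  "R_diag r s a b = (if a = b then s else if a > b then r * s else 1)"

lemma R_mat_entry:
  assumes "a \<in> {1..n}" "b \<in> {1..n}"
  shows "R_mat n r s [a, b] [c, d] = (if c = a \<and> d = b then R_diag r s a b else 0)
    + (if c = b \<and> d = a \<and> a > b then s - r else 0)"
proof -
  have diag: "tensor_mat [unit_mat i i, unit_mat j j] [a, b] [c, d]
      = of_bool (i = a \<and> j = b) * of_bool (c = i \<and> d = j)"
    and off: "tensor_mat [unit_mat i j, unit_mat j i] [a, b] [c, d]
      = of_bool (i = a \<and> j = b) * of_bool (c = j \<and> d = i)" for i j
    by (auto simp: tensor_mat_def unit_mat_def lessThan_Suc)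
  have "(\<Sum>i\<in>{1..n}. tensor_mat [unit_mat i i, unit_mat i i] [a, b] [c, d])
      = (\<Sum>i\<in>{1..n}. if i = a then of_bool (a = b \<and> c = a \<and> d = a) else 0)"
    unfolding diag by (rule sum.cong) auto
  also have "\<dots> = of_bool (a = b \<and> c = a \<and> d = a)" using assms by simp
  finally show ?thesis
    unfolding R_mat_def diag off sum_pairs_of_bool using assms by (auto simp: R_diag_def)
qed

lemma R_mat_row:
  assumes "a \<in> {1..n}" "b \<in> {1..n}" and "K \<in> multi_indices n 2"
  shows "R_mat n r s [a, b] K
    = (if K = [a, b] then R_diag r s a b else 0) + (if K = [b, a] \<and> a > b then s - r else 0)"
proof -
  obtain c d where K: "K = [c, d]" using assms(3) by (rule multi_indices_2E)
  show ?thesis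
    unfolding K R_mat_entry[OF assms(1,2)] list.inject simp_thms conj_assoc ..
qed

lemma R_mat_column:
  assumes "K \<in> multi_indices n 2"
  shows "R_mat n r s K [c, d]
    = (if K = [c, d] then R_diag r s c d else 0) + (if K = [d, c] \<and> d > c then s - r else 0)"
proof -
  obtain e f where K: "K = [e, f]" and ef: "e \<in> {1..n}" "f \<in> {1..n}"
    using assms by (rule multi_indices_2E)
  have "(if c = e \<and> d = f then R_diag r s e f else 0) = (if K = [c, d] then R_diag r s c d else 0)"
    and "(if c = f \<and> d = e \<and> e > f then s - r else 0) = (if K = [d, c] \<and> d > c then s - r else 0)"
    by (auto simp: K)
  then show ?thesis
    unfolding K R_mat_entry[OF ef] by (simp only:)
qed

text \<open>
  A row of \<open>R\<close> has at most two nonzero entries, on the diagonal and at the transposed index, and likewise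
  a column. Multiplication by \<open>R\<close> therefore mixes only \<open>[a, b]\<close> with \<open>[b, a]\<close>.
\<close>

lemma R_mult_left:
  assumes ab: "a \<in> {1..n}" "b \<in> {1..n}"
    and N: "\<And>K. K \<in> multi_indices n 2 \<Longrightarrow> N K J \<in> carrier (free_algebra X)"
  shows "op_mult (free_algebra X) n 2 (scalar_op (free_algebra X) (R_mat n r s)) N [a, b] J
    = scalar (R_diag r s a b) * N [a, b] J
      + (if a > b then scalar (s - r) * N [b, a] J else 0)"
proof -
  let ?M = "multi_indices n 2"
  have "op_mult (free_algebra X) n 2 (scalar_op (free_algebra X) (R_mat n r s)) N [a, b] J
      = (\<Sum>K\<in>?M. scalar (R_mat n r s [a, b] K) * N K J)"
    unfolding op_mult_def scalar_op_def using N
    by (intro finsum_free_algebra_eq) (simp_all add: free_algebra_closed scalar_mem_free_algebra)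
  also have "\<dots> = (\<Sum>K\<in>?M. if K = [a, b] then scalar (R_diag r s a b) * N K J else 0)
      + (\<Sum>K\<in>?M. if K = [b, a] \<and> a > b then scalar (s - r) * N K J else 0)"
    unfolding sum.distrib[symmetric]
    by (rule sum.cong[OF refl]) (simp only: R_mat_row[OF ab] single_if_add_mult)
  also have "\<dots> = scalar (R_diag r s a b) * N [a, b] J
      + (if a > b then scalar (s - r) * N [b, a] J else 0)"
    using finite_multi_indices[of n 2] pair_in_multi_indices[OF ab] pair_in_multi_indices[OF ab(2,1)]
    by (cases "a > b") simp_all
  finally show ?thesis .
qed

lemma R_mult_right:
  assumes cd: "c \<in> {1..n}" "d \<in> {1..n}"
    and N: "\<And>K. K \<in> multi_indices n 2 \<Longrightarrow> N I K \<in> carrier (free_algebra X)"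
  shows "op_mult (free_algebra X) n 2 N (scalar_op (free_algebra X) (R_mat n r s)) I [c, d]
    = scalar (R_diag r s c d) * N I [c, d]
      + (if d > c then scalar (s - r) * N I [d, c] else 0)"
proof -
  let ?M = "multi_indices n 2"
  have "op_mult (free_algebra X) n 2 N (scalar_op (free_algebra X) (R_mat n r s)) I [c, d]
      = (\<Sum>K\<in>?M. scalar (R_mat n r s K [c, d]) * N I K)"
    unfolding op_mult_def scalar_op_def using N
    by (intro finsum_free_algebra_eq)
      (simp_all add: free_algebra_closed scalar_mem_free_algebra
        scalar_commute[of _ "N I K" for K, symmetric])
  also have "\<dots> = (\<Sum>K\<in>?M. if K = [c, d] then scalar (R_diag r s c d) * N I K else 0)
      + (\<Sum>K\<in>?M. if K = [d, c] \<and> d > c then scalar (s - r) * N I K else 0)"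
    unfolding sum.distrib[symmetric]
    by (rule sum.cong[OF refl]) (simp only: R_mat_column single_if_add_mult)
  also have "\<dots> = scalar (R_diag r s c d) * N I [c, d]
      + (if d > c then scalar (s - r) * N I [d, c] else 0)"
    using finite_multi_indices[of n 2] pair_in_multi_indices[OF cd] pair_in_multi_indices[OF cd(2,1)]
    by (cases "d > c") simp_all
  finally show ?thesis .
qed

section \<open>Relations between the generators\<close>

definition GL_gens :: "nat \<Rightarrow> GL_gen set" where
  "GL_gens n = {T i j |i j. i \<in> {1..n} \<and> j \<in> {1..n}} \<union> {T' i j |i j. i \<in> {1..n} \<and> j \<in> {1..n}}"

abbreviation free_t :: "nat \<Rightarrow> nat \<Rightarrow> GL_gen word \<Rightarrow>\<^sub>0 complex" where
  "free_t i j \<equiv> free_gen (T i j)"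

lemma GL_free_conv: "GL_free n = free_algebra (GL_gens n)"
  by (simp add: GL_free_def GL_gens_def)

lemma free_t_mem: "i \<in> {1..n} \<Longrightarrow> j \<in> {1..n} \<Longrightarrow> free_t i j \<in> carrier (GL_free n)"
  unfolding GL_free_conv by (rule free_gen_mem) (simp add: GL_gens_def)

lemma free_t'_mem: "i \<in> {1..n} \<Longrightarrow> j \<in> {1..n} \<Longrightarrow> free_gen (T' i j) \<in> carrier (GL_free n)"
  unfolding GL_free_conv by (rule free_gen_mem) (simp add: GL_gens_def)

lemma ideal_GL_ideal: "ideal (GL_ideal n r s) (GL_free n)"
proof -
  interpret calg_hom "GL_free n" "GL_free n" id
    unfolding GL_free_conv by (rule calg_hom_id)
  let ?A = "GL_free n"
  have op: "op_mult ?A n 2 (scalar_op ?A M) (op_mult ?A n 2 (leg_op ?A n 2 free_t k) (leg_op ?A n 2 free_t l)) I J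
      \<ominus>\<^bsub>?A\<^esub> op_mult ?A n 2 (op_mult ?A n 2 (leg_op ?A n 2 free_t l) (leg_op ?A n 2 free_t k)) (scalar_op ?A M) I J
    \<in> carrier ?A" for M k l I J
    unfolding scalar_op_def
    by (intro R.minus_closed op_mult_closed leg_op_closed smult_closed free_t_mem R.one_closed)
  then have "RTT_relators n r s \<subseteq> carrier ?A"
    unfolding RTT_relators_def Let_def by blast
  moreover have
    "(\<Oplus>\<^bsub>?A\<^esub>k\<in>{1..n}. free_gen (T' i k) \<otimes>\<^bsub>?A\<^esub> free_t k j) \<ominus>\<^bsub>?A\<^esub> id_mat i j \<odot>\<^bsub>?A\<^esub> \<one>\<^bsub>?A\<^esub> \<in> carrier ?A"
    "(\<Oplus>\<^bsub>?A\<^esub>k\<in>{1..n}. free_t i k \<otimes>\<^bsub>?A\<^esub> free_gen (T' k j)) \<ominus>\<^bsub>?A\<^esub> id_mat i j \<odot>\<^bsub>?A\<^esub> \<one>\<^bsub>?A\<^esub> \<in> carrier ?A"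
    if "i \<in> {1..n}" "j \<in> {1..n}" for i j
    by (intro R.minus_closed R.finsum_closed Pi_I smult_closed R.m_closed R.one_closed
        free_t_mem free_t'_mem that; assumption)+
  then have "inverse_relators n \<subseteq> carrier ?A"
    unfolding inverse_relators_def Let_def by blast
  ultimately show ?thesis
    unfolding GL_ideal_def by (intro R.genideal_ideal Un_least)
qed

lemma calg_hom_Fun_GL:
  "calg_hom (GL_free n) (Fun_GL n r s) ((+>\<^bsub>GL_free n\<^esub>) (GL_ideal n r s))"
  using calg_hom_quotient[OF ideal_GL_ideal[unfolded GL_free_conv]]
  by (simp only: Fun_GL_def GL_free_conv)

lemma Fun_GL_smult_coset:
  assumes "p \<in> carrier (GL_free n)"
  shows "d \<odot>\<^bsub>Fun_GL n r s\<^esub> (GL_ideal n r s +>\<^bsub>GL_free n\<^esub> p)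
      = GL_ideal n r s +>\<^bsub>GL_free n\<^esub> (scalar d * p)"
    and "scalar d * p \<in> carrier (GL_free n)"
proof -
  interpret calg_hom "GL_free n" "Fun_GL n r s" "(+>\<^bsub>GL_free n\<^esub>) (GL_ideal n r s)"
    by (rule calg_hom_Fun_GL)
  have "d \<odot>\<^bsub>GL_free n\<^esub> p = scalar d * p"
    by (simp only: GL_free_conv free_algebra_sel)
  then show "d \<odot>\<^bsub>Fun_GL n r s\<^esub> (GL_ideal n r s +>\<^bsub>GL_free n\<^esub> p)
      = GL_ideal n r s +>\<^bsub>GL_free n\<^esub> (scalar d * p)"
    and "scalar d * p \<in> carrier (GL_free n)"
    using hom_smult[OF assms, of d] smult_closed[OF assms, of d] by simp_all
qed

lemma RTT_relation:
  assumes "a \<in> {1..n}" "b \<in> {1..n}" "c \<in> {1..n}" "d \<in> {1..n}"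
  shows "scalar (R_diag r s a b) * (free_t a c * free_t b d)
      + (if a > b then scalar (s - r) * (free_t b c * free_t a d) else 0)
    - (scalar (R_diag r s c d) * (free_t b d * free_t a c)
      + (if d > c then scalar (s - r) * (free_t b c * free_t a d) else 0))
    \<in> GL_ideal n r s"
proof -
  let ?A = "free_algebra (GL_gens n)"
  interpret calg_hom ?A ?A id by (rule calg_hom_id)
  let ?T1 = "leg_op ?A n 2 free_t 1" and ?T2 = "leg_op ?A n 2 free_t 2"
  let ?R = "scalar_op ?A (R_mat n r s)"
  have free_t: "free_t i j \<in> carrier ?A" if "i \<in> {1..n}" "j \<in> {1..n}" for i j
    using free_t_mem[OF that] by (simp add: GL_free_conv)
  have T_closed: "op_mult ?A n 2 ?T1 ?T2 I J \<in> carrier ?A" "op_mult ?A n 2 ?T2 ?T1 I J \<in> carrier ?A" for I J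
    by (rule op_mult_closed; rule leg_op_closed; rule free_t; assumption)+
  have R_closed: "?R I J \<in> carrier ?A" for I J
    unfolding scalar_op_def by (intro smult_closed R.one_closed)
  have relator: "op_mult ?A n 2 ?R (op_mult ?A n 2 ?T1 ?T2) [a, b] [c, d]
      \<ominus>\<^bsub>?A\<^esub> op_mult ?A n 2 (op_mult ?A n 2 ?T2 ?T1) ?R [a, b] [c, d] \<in> RTT_relators n r s"
    unfolding RTT_relators_def Let_def GL_free_conv using assms pair_in_multi_indices by blast
  have legs: "op_mult ?A n 2 ?T1 ?T2 [a, b] [c, d] = free_t a c * free_t b d"
    "op_mult ?A n 2 ?T2 ?T1 [a, b] [c, d] = free_t b d * free_t a c"
    if "a \<in> {1..n}" "b \<in> {1..n}" "c \<in> {1..n}" "d \<in> {1..n}" for a b c d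
    by ((rule two_legs[where t = free_t]; (rule free_t)?), (assumption | rule that)+)+
  have "op_mult ?A n 2 ?R (op_mult ?A n 2 ?T1 ?T2) [a, b] [c, d]
      \<ominus>\<^bsub>?A\<^esub> op_mult ?A n 2 (op_mult ?A n 2 ?T2 ?T1) ?R [a, b] [c, d]
    = op_mult ?A n 2 ?R (op_mult ?A n 2 ?T1 ?T2) [a, b] [c, d]
      - op_mult ?A n 2 (op_mult ?A n 2 ?T2 ?T1) ?R [a, b] [c, d]"
    by (intro a_minus_free_algebra op_mult_closed[OF R_closed T_closed(1)]
        op_mult_closed[OF T_closed(2) R_closed])
  with relator have "op_mult ?A n 2 ?R (op_mult ?A n 2 ?T1 ?T2) [a, b] [c, d]
      - op_mult ?A n 2 (op_mult ?A n 2 ?T2 ?T1) ?R [a, b] [c, d] \<in> RTT_relators n r s"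
    by (simp only:)
  then have "op_mult ?A n 2 ?R (op_mult ?A n 2 ?T1 ?T2) [a, b] [c, d]
      - op_mult ?A n 2 (op_mult ?A n 2 ?T2 ?T1) ?R [a, b] [c, d] \<in> GL_ideal n r s"
    unfolding GL_ideal_def genideal_def by blast
  then show ?thesis
    unfolding R_mult_left[where N = "op_mult ?A n 2 ?T1 ?T2", OF assms(1,2) T_closed(1)]
      R_mult_right[where N = "op_mult ?A n 2 ?T2 ?T1", OF assms(3,4) T_closed(2)]
      legs[OF assms] legs[OF assms(2,1,3,4)] legs[OF assms(1,2,4,3)] .
qed

text \<open>
  The relation \<open>R T\<^sub>1 T\<^sub>2 = T\<^sub>2 T\<^sub>1 R\<close> at row \<open>[a, b]\<close>, where the off-diagonal part of \<open>R\<close> vanishes, and at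
  the columns \<open>[d, c]\<close> and \<open>[c, d]\<close>.
\<close>

lemma exchange_relations:
  assumes "a \<in> {1..n}" "b \<in> {1..n}" "c \<in> {1..n}" "d \<in> {1..n}" and "a < b" "c < d"
  shows "free_t a d * free_t b c - scalar (r * s) * (free_t b c * free_t a d) \<in> GL_ideal n r s"
    and "free_t a c * free_t b d - free_t b d * free_t a c - scalar (s - r) * (free_t b c * free_t a d)
      \<in> GL_ideal n r s"
proof -
  have R: "R_diag r s a b = 1" "R_diag r s d c = r * s" "R_diag r s c d = 1"
    and less: "(b < a) = False" "(c < d) = True" "(d < c) = False"
    using assms(5,6) by (auto simp: R_diag_def)
  show "free_t a d * free_t b c - scalar (r * s) * (free_t b c * free_t a d) \<in> GL_ideal n r s"
    using RTT_relation[OF assms(1,2,4,3), of r s]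
    by (simp only: R less if_False add_0_right single_one mult_1_left)
  show "free_t a c * free_t b d - free_t b d * free_t a c - scalar (s - r) * (free_t b c * free_t a d)
      \<in> GL_ideal n r s"
    using RTT_relation[OF assms(1-4), of r s]
    by (simp only: R less if_False if_True add_0_right single_one mult_1_left diff_diff_eq)
qed

section \<open>The quantum determinant\<close>

definition t_monomial :: "nat list \<Rightarrow> nat list \<Rightarrow> GL_gen word \<Rightarrow>\<^sub>0 complex" where
  "t_monomial is js = prod_list (map2 free_t is js)"

lemma t_monomial_mem:
  assumes "set is \<subseteq> {1..n}" "set js \<subseteq> {1..n}"
  shows "t_monomial is js \<in> carrier (GL_free n)"
  using assms
proof (induction "is" js rule: list_induct2')
  case (4 i is' j js)
  then show ?case
    using free_t_mem[of i n j] by (simp add: t_monomial_def GL_free_conv free_algebra_closed)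
qed (simp_all add: t_monomial_def GL_free_conv free_algebra_def zero_word_def)

lemma t_monomial_split:
  assumes "length is = length js"
  shows "t_monomial (is @ a # b # is') (js @ c # d # js')
    = t_monomial is js * (free_t a c * free_t b d) * t_monomial is' js'"
  using assms by (simp add: t_monomial_def mult.assoc)

text \<open>
  A relation between quadratic expressions remains valid inside longer monomials, as the ideal is
  two-sided and the constant \<open>k\<close> can be pulled out.
\<close>

lemma monomial_exchange:
  assumes S: "ideal S (free_algebra X)"
    and p: "p \<in> carrier (free_algebra X)" and q: "q \<in> carrier (free_algebra X)"
    and "x + scalar k * w - scalar k * (z + scalar k * y) \<in> S"
  shows "p * x * q + scalar k * (p * w * q)
    - scalar k * (p * z * q + scalar k * (p * y * q)) \<in> S"
proof -
  interpret ideal S "free_algebra X" by fact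
  have "p * (x + scalar k * w
      - scalar k * (z + scalar k * y)) * q \<in> S"
    using I_r_closed[OF I_l_closed[OF assms(4) p] q] by simp
  also have "p * (x + scalar k * w
      - scalar k * (z + scalar k * y)) * q
    = p * x * q + scalar k * (p * w * q)
    - scalar k * (p * z * q + scalar k * (p * y * q))"
    by (simp only: distrib_left distrib_right left_diff_distrib right_diff_distrib
        scalar_left_commute[of p] mult.assoc)
  finally show ?thesis .
qed

lemma swap_lists_in_range:
  assumes "ps @ a # b # qs \<in> permutations_of_set A"
  shows "a \<in> A" "b \<in> A" "set ps \<subseteq> A" "set qs \<subseteq> A"
  using permutations_of_setD(1)[OF assms] by auto

text \<open>
  This is the hypothesis of \<open>q_determinant_congruent\<close> for sums over the row indices, with \<open>q = -s\<close>;
  \<open>row_swap\<close> is the one for sums over the column indices, with \<open>q = (-r)\<^sup>-\<^sup>1\<close>.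
\<close>

lemma column_swap:
  assumes "length ps = length us" "a < b" "c < d"
    and ab: "ps @ a # b # qs \<in> permutations_of_set {1..n}"
    and cd: "us @ c # d # vs \<in> permutations_of_set {1..n}"
  shows "t_monomial (ps @ a # b # qs) (us @ d # c # vs)
      + scalar (- s) * t_monomial (ps @ b # a # qs) (us @ d # c # vs)
    - scalar (- s) * (t_monomial (ps @ a # b # qs) (us @ c # d # vs)
      + scalar (- s) * t_monomial (ps @ b # a # qs) (us @ c # d # vs)) \<in> GL_ideal n r s"
proof -
  note ideal = ideal_GL_ideal[of n r s, unfolded GL_free_conv]
  note ran = swap_lists_in_range[OF ab] swap_lists_in_range[OF cd]
  note rel = exchange_relations[OF ran(1,2,5,6) assms(2,3), where r = r and s = s]
  note mem = t_monomial_mem[unfolded GL_free_conv]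
  show ?thesis
    unfolding t_monomial_split[OF assms(1)]
    by (rule monomial_exchange[OF ideal mem[OF ran(3,7)] mem[OF ran(4,8)]
          free.column_exchange[OF ideal_subspace[OF ideal] rel]])
qed

lemma row_swap:
  assumes r: "r \<noteq> 0" and "length ps = length us" "a < b" "c < d"
    and ab: "ps @ a # b # qs \<in> permutations_of_set {1..n}"
    and cd: "us @ c # d # vs \<in> permutations_of_set {1..n}"
  shows "t_monomial (us @ d # c # vs) (ps @ a # b # qs)
      + scalar (inverse (- r)) * t_monomial (us @ d # c # vs) (ps @ b # a # qs)
    - scalar (inverse (- r)) * (t_monomial (us @ c # d # vs) (ps @ a # b # qs)
      + scalar (inverse (- r)) * t_monomial (us @ c # d # vs) (ps @ b # a # qs))
    \<in> GL_ideal n r s"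
proof -
  note ideal = ideal_GL_ideal[of n r s, unfolded GL_free_conv]
  note ran = swap_lists_in_range[OF cd] swap_lists_in_range[OF ab]
  note rel = exchange_relations[OF ran(1,2,5,6) assms(4,3), where r = r and s = s]
  note mem = t_monomial_mem[unfolded GL_free_conv]
  show ?thesis
    unfolding t_monomial_split[OF assms(2)[symmetric]]
    by (rule monomial_exchange[OF ideal mem[OF ran(3,7)] mem[OF ran(4,8)]
          free.row_exchange[OF ideal_subspace[OF ideal] r rel]])
qed

lemma sum_permutes_conv_lists:
  "(\<Sum>\<sigma> | \<sigma> permutes {1..n}. g (inversions n \<sigma>) (map \<sigma> [1..<n+1]))
    = (\<Sum>xs\<in>permutations_of_set {1..n}. g (list_inversions xs) xs)"
proof -
  have "(\<Sum>\<sigma> | \<sigma> permutes {1..n}. g (inversions n \<sigma>) (map \<sigma> [1..<n+1]))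
      = (\<Sum>\<sigma> | \<sigma> permutes {1..n}. g (list_inversions (map \<sigma> [1..<n+1])) (map \<sigma> [1..<n+1]))"
    by (rule sum.cong[OF refl]) (simp only: list_inversions_map mem_Collect_eq)
  also have "\<dots> = (\<Sum>xs\<in>permutations_of_set {1..n}. g (list_inversions xs) xs)"
    by (rule sum.reindex_bij_betw[OF bij_betw_permutes_permutations_of_set])
  finally show ?thesis .
qed

lemma tensor_vec_unit_vecs:
  assumes "length I = n"
  shows "tensor_vec (map (\<lambda>k. unit_vec (\<sigma> k)) [1..<n+1]) I = of_bool (I = map \<sigma> [1..<n+1])"
proof -
  have "tensor_vec (map (\<lambda>k. unit_vec (\<sigma> k)) [1..<n+1]) I = (\<Prod>p<n. of_bool (I ! p = \<sigma> (Suc p)))"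
    unfolding tensor_vec_def by (rule prod.cong) (simp_all add: unit_vec_def del: upt_Suc)
  also have "\<dots> = of_bool (\<forall>p<n. I ! p = \<sigma> (Suc p))"
    by (simp only: prod_of_bool[OF finite_lessThan] Ball_def lessThan_iff)
  also have "(\<forall>p<n. I ! p = \<sigma> (Suc p)) \<longleftrightarrow> I = map \<sigma> [1..<n+1]"
    using assms by (auto simp: list_eq_iff_nth_eq simp del: upt_Suc)
  finally show ?thesis .
qed

text \<open>
  The common shape of \<open>eps_bra\<close> and \<open>eps_ket\<close>: their coefficients vanish at an index with repeated
  entries, and otherwise depend only on the inversions of the index.
\<close>

lemma sum_permutes_tensor_vec:
  assumes "length I = n"
  shows "(\<Sum>\<sigma> | \<sigma> permutes {1..n}. c (inversions n \<sigma>) *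
      tensor_vec (map (\<lambda>k. unit_vec (\<sigma> k)) [1..<n+1]) I)
    = (if I \<in> permutations_of_set {1..n} then c (list_inversions I) else 0)"
proof -
  have "(\<Sum>\<sigma> | \<sigma> permutes {1..n}. c (inversions n \<sigma>) *
      tensor_vec (map (\<lambda>k. unit_vec (\<sigma> k)) [1..<n+1]) I)
    = (\<Sum>xs\<in>permutations_of_set {1..n}. c (list_inversions xs) * of_bool (I = xs))"
    unfolding tensor_vec_unit_vecs[OF assms]
    by (rule sum_permutes_conv_lists[where g = "\<lambda>l xs. c l * of_bool (I = xs)"])
  also have "\<dots> = (\<Sum>xs\<in>permutations_of_set {1..n}. if xs = I then c (list_inversions I) else 0)"
    by (rule sum.cong) auto
  finally show ?thesis by simp
qed

text \<open>
  A representative of the quantum determinant in the free algebra, in which the sum over all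
  multi-indices has already been restricted to permutations.
\<close>

definition qdet_free :: "nat \<Rightarrow> complex \<Rightarrow> complex \<Rightarrow> GL_gen word \<Rightarrow>\<^sub>0 complex" where
  "qdet_free n r s = scalar (r ^ (n * (n - 1) div 2) / qfact r s n) *
    (\<Sum>ys\<in>permutations_of_set {1..n}. \<Sum>xs\<in>permutations_of_set {1..n}.
      scalar ((- s) ^ list_inversions xs * inverse (- r) ^ list_inversions ys) *
        t_monomial xs ys)"

lemma permutation_is_multi_index:
  "permutations_of_set {1..n} \<subseteq> multi_indices n n"
proof
  fix xs assume "xs \<in> permutations_of_set {1..n}"
  then show "xs \<in> multi_indices n n"
    using length_finite_permutations_of_set[of xs "{1..n}"] permutations_of_setD(1)[of xs "{1..n}"]
    by (simp add: multi_indices_def)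
qed

lemma
  shows qdet_eq_coset: "qdet n r s = GL_ideal n r s +>\<^bsub>GL_free n\<^esub> qdet_free n r s"
  and qdet_free_mem: "qdet_free n r s \<in> carrier (GL_free n)"
proof -
  let ?A = "GL_free n" and ?B = "Fun_GL n r s" and ?I = "GL_ideal n r s"
  let ?h = "(+>\<^bsub>?A\<^esub>) ?I"
  let ?M = "multi_indices n n" and ?P = "permutations_of_set {1..n}"
  interpret calg_hom ?A ?B ?h by (rule calg_hom_Fun_GL)
  let ?TA = "foldr (op_mult ?A n n) (map (leg_op ?A n n free_t) [1..<n+1]) (op_one ?A n)"
  let ?TB = "foldr (op_mult ?B n n) (map (leg_op ?B n n (GL_t n r s)) [1..<n+1]) (op_one ?B n)"
  let ?c = "\<lambda>I J. eps_bra n r s I * eps_ket n r J"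
  have h_t: "GL_t n r s = (\<lambda>i j. ?h (free_t i j))"
    by (intro ext) (simp add: GL_t_def)
  have TB: "?h (?TA I J) = ?TB I J" for I J
    unfolding h_t by (rule hom_legs) (rule free_t_mem)
  have TA_closed: "?TA I J \<in> carrier ?A" for I J
    by (rule legs_closed) (rule free_t_mem)
  have TA: "?TA I J = t_monomial I J" if "I \<in> ?M" "J \<in> ?M" for I J
    using legs_free[where k = 0 and m = n and t = free_t and n = n and X = "GL_gens n"] that free_t_mem
    by (simp add: t_monomial_def GL_free_conv del: upt_Suc)
  have scaled: "?c I J \<odot>\<^bsub>?A\<^esub> ?TA I J \<in> carrier ?A" for I J
    by (intro smult_closed TA_closed)
  \<comment> \<open>The defining expression of the determinant, read in the free algebra.\<close>
  define q where "q = (\<Oplus>\<^bsub>?A\<^esub>I\<in>?M. \<Oplus>\<^bsub>?A\<^esub>J\<in>?M. ?c I J \<odot>\<^bsub>?A\<^esub> ?TA I J)"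
  have row_closed: "(\<Oplus>\<^bsub>?A\<^esub>J\<in>?M. ?c I J \<odot>\<^bsub>?A\<^esub> ?TA I J) \<in> carrier ?A" for I
    by (intro R.finsum_closed Pi_I scaled)
  have q_closed: "q \<in> carrier ?A"
    unfolding q_def by (intro R.finsum_closed Pi_I row_closed)
  have "qdet n r s = ?h q"
    unfolding qdet_def Let_def q_def
  proof (rule hom_finsum_eq[symmetric])
    fix I
    show "?h (\<Oplus>\<^bsub>?A\<^esub>J\<in>?M. ?c I J \<odot>\<^bsub>?A\<^esub> ?TA I J) = (\<Oplus>\<^bsub>?B\<^esub>J\<in>?M. ?c I J \<odot>\<^bsub>?B\<^esub> ?TB I J)"
      by (rule hom_finsum_eq) (simp_all only: scaled hom_smult[OF TA_closed] TB)
  qed (rule row_closed)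
  moreover have "q = qdet_free n r s"
  proof -
    let ?u = "\<lambda>I J. scalar (?c I J) * t_monomial I J"
    have bra: "eps_bra n r s I = (if I \<in> ?P then (- s) ^ list_inversions I / qfact r s n else 0)"
      and ket: "eps_ket n r I = (if I \<in> ?P then
        r ^ (n * (n - 1) div 2) * inverse (- r) ^ list_inversions I else 0)" if "I \<in> ?M" for I
    proof -
      have len: "length I = n" using that by (simp add: multi_indices_def)
      show "eps_bra n r s I = (if I \<in> ?P then (- s) ^ list_inversions I / qfact r s n else 0)"
        unfolding eps_bra_def
          sum_permutes_tensor_vec[OF len, where c = "\<lambda>l. (- s) ^ l"] by simp
      show "eps_ket n r I = (if I \<in> ?P then
        r ^ (n * (n - 1) div 2) * inverse (- r) ^ list_inversions I else 0)"
        unfolding eps_ket_def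
          sum_permutes_tensor_vec[OF len, where c = "\<lambda>l. (- r) powi (- int l)"]
        by (cases "I \<in> ?P")
          (simp_all only: if_True if_False mult_zero_right power_int_minus power_int_of_nat power_inverse)
    qed
    have scaled': "?u I J \<in> carrier ?A" if "I \<in> ?M" "J \<in> ?M" for I J
      using scaled[of I J] TA[OF that] by (simp add: GL_free_conv)
    have row: "(\<Oplus>\<^bsub>?A\<^esub>J\<in>?M. ?c I J \<odot>\<^bsub>?A\<^esub> ?TA I J) = (\<Sum>J\<in>?M. ?u I J)" if "I \<in> ?M" for I
      unfolding GL_free_conv
    proof (rule finsum_free_algebra_eq, fold GL_free_conv)
      fix J assume "J \<in> ?M"
      with that TA scaled' show "?c I J \<odot>\<^bsub>?A\<^esub> ?TA I J = ?u I J" "?u I J \<in> carrier ?A"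
        by (simp_all add: GL_free_conv del: upt_Suc)
    qed
    have "q = (\<Sum>I\<in>?M. \<Sum>J\<in>?M. ?u I J)"
      unfolding q_def GL_free_conv
      by (rule finsum_free_algebra_eq, fold GL_free_conv)
        (simp_all only: row row_closed flip: row)
    also have "\<dots> = (\<Sum>I\<in>?P. \<Sum>J\<in>?M. ?u I J)"
      by (rule sum.mono_neutral_right[OF finite_multi_indices permutation_is_multi_index])
        (simp add: bra)
    also have "\<dots> = (\<Sum>I\<in>?P. \<Sum>J\<in>?P. ?u I J)"
      by (rule sum.cong[OF refl], rule sum.mono_neutral_right[OF finite_multi_indices permutation_is_multi_index])
        (simp add: ket)
    also have "\<dots> = (\<Sum>J\<in>?P. \<Sum>I\<in>?P. ?u I J)" by (rule sum.swap)
    also have "\<dots> = qdet_free n r s"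
      unfolding qdet_free_def sum_distrib_left
    proof (intro sum.cong refl)
      fix I J assume "I \<in> ?P" "J \<in> ?P"
      then have "?c I J = r ^ (n * (n - 1) div 2) / qfact r s n *
          ((- s) ^ list_inversions I * inverse (- r) ^ list_inversions J)"
        using permutation_is_multi_index[of n] by (simp add: bra ket subset_iff)
      then show "?u I J = scalar (r ^ (n * (n - 1) div 2) / qfact r s n) *
          (scalar ((- s) ^ list_inversions I * inverse (- r) ^ list_inversions J) *
            t_monomial I J)"
        by (simp only: free.scale_scale)
    qed
    finally show ?thesis .
  qed
  ultimately show "qdet n r s = ?h (qdet_free n r s)" "qdet_free n r s \<in> carrier ?A"
    using q_closed by simp_all
qed

text \<open>
  Moving the indices of one side into order costs \<open>-s\<close> per inversion and the weights of the other side
  contribute \<open>(-r)\<^sup>-\<^sup>1\<close>, so that the generating function of inversions is evaluated at \<open>s/r\<close>.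
\<close>

lemma quantum_determinant_normalization:
  assumes "r \<noteq> 0" "r \<noteq> s" and "\<forall>k\<in>{1..n}. qint r s k \<noteq> 0"
  shows "r ^ (n * (n - 1) div 2) / qfact r s n *
    (\<Sum>xs\<in>permutations_of_set {1..n}. (- s * inverse (- r)) ^ list_inversions xs) = 1"
proof -
  have "qfact r s n \<noteq> 0"
    using assms(3) by (simp add: qfact_def)
  moreover have "- s * inverse (- r) = s / r" by (simp add: divide_inverse)
  ultimately show ?thesis
    using qfact_eq_inversion_sum[OF assms(1,2), of n] by simp
qed

lemma qdet_free_column:
  assumes "r \<noteq> 0" "s \<noteq> 0" "r \<noteq> s" and "\<forall>k\<in>{1..n}. qint r s k \<noteq> 0"
    and ys: "ys \<in> permutations_of_set {1..n}"
  shows "qdet_free n r s - scalar (inverse ((- s) ^ list_inversions ys)) *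
      (\<Sum>xs\<in>permutations_of_set {1..n}.
        scalar ((- s) ^ list_inversions xs) * t_monomial xs ys)
    \<in> GL_ideal n r s"
  unfolding qdet_free_def
proof (rule free.q_determinant_congruent[OF _ _ _ _ _ ys])
  show "free.subspace (GL_ideal n r s)"
    by (rule ideal_subspace) (rule ideal_GL_ideal[unfolded GL_free_conv])
  show "finite {1..n}" by simp
  show "- s \<noteq> 0" using assms(2) by simp
  show "r ^ (n * (n - 1) div 2) / qfact r s n *
      (\<Sum>ys\<in>permutations_of_set {1..n}. (- s * inverse (- r)) ^ list_inversions ys) = 1"
    by (rule quantum_determinant_normalization[OF assms(1,3,4)])
qed (rule column_swap)

text \<open>
  The double sum is symmetric in its two summations, up to the weights attached to them. Carrying out
  the one over the column indices first gives the expansion along rows.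
\<close>

lemma qdet_free_row:
  assumes "r \<noteq> 0" "r \<noteq> s" and "\<forall>k\<in>{1..n}. qint r s k \<noteq> 0"
    and xs: "xs \<in> permutations_of_set {1..n}"
  shows "qdet_free n r s - scalar (inverse (inverse (- r) ^ list_inversions xs)) *
      (\<Sum>ys\<in>permutations_of_set {1..n}.
        scalar (inverse (- r) ^ list_inversions ys) * t_monomial xs ys)
    \<in> GL_ideal n r s"
proof -
  have "qdet_free n r s = scalar (r ^ (n * (n - 1) div 2) / qfact r s n) *
    (\<Sum>xs\<in>permutations_of_set {1..n}. \<Sum>ys\<in>permutations_of_set {1..n}.
      scalar (inverse (- r) ^ list_inversions ys * (- s) ^ list_inversions xs) *
        t_monomial xs ys)"
    unfolding qdet_free_def by (subst sum.swap) (simp only: mult.commute[of "(- s) ^ k" for k])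
  also have "\<dots> - scalar (inverse (inverse (- r) ^ list_inversions xs)) *
      (\<Sum>ys\<in>permutations_of_set {1..n}.
        scalar (inverse (- r) ^ list_inversions ys) * t_monomial xs ys)
    \<in> GL_ideal n r s"
  proof (rule free.q_determinant_congruent[OF _ _ _ _ _ xs, where W = "\<lambda>xs ys. t_monomial ys xs"])
    show "free.subspace (GL_ideal n r s)"
      by (rule ideal_subspace) (rule ideal_GL_ideal[unfolded GL_free_conv])
    show "finite {1..n}" by simp
    show "inverse (- r) \<noteq> 0" using assms(1) by simp
    show "r ^ (n * (n - 1) div 2) / qfact r s n *
        (\<Sum>ys\<in>permutations_of_set {1..n}. (inverse (- r) * - s) ^ list_inversions ys) = 1"
      using quantum_determinant_normalization[OF assms(1-3)] by (simp only: mult.commute[of "- s"])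
  qed (rule row_swap[OF assms(1)])
  finally show ?thesis .
qed

text \<open>
  Both expansions have this form: \<open>f\<close> yields the row indices and \<open>g\<close> the column indices, one of them
  being the permutation summed over and the other one fixed.
\<close>

lemma signed_sum_eq_coset:
  fixes n :: nat and r s :: complex and c :: "nat \<Rightarrow> complex"
    and f g :: "(nat \<Rightarrow> nat) \<Rightarrow> nat \<Rightarrow> nat"
  assumes f: "\<forall>\<sigma>. \<sigma> permutes {1..n} \<longrightarrow> f \<sigma> ` {1..n} \<subseteq> {1..n}"
    and g: "\<forall>\<sigma>. \<sigma> permutes {1..n} \<longrightarrow> g \<sigma> ` {1..n} \<subseteq> {1..n}"
  defines "p \<equiv> (\<Sum>\<sigma> | \<sigma> permutes {1..n}. scalar (c (inversions n \<sigma>)) *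
        t_monomial (map (f \<sigma>) [1..<n+1]) (map (g \<sigma>) [1..<n+1]))"
  shows "(\<Oplus>\<^bsub>Fun_GL n r s\<^esub>\<sigma>\<in>{\<sigma>. \<sigma> permutes {1..n}}.
        c (inversions n \<sigma>) \<odot>\<^bsub>Fun_GL n r s\<^esub>
          ordered_prod (Fun_GL n r s) n (\<lambda>k. GL_t n r s (f \<sigma> k) (g \<sigma> k)))
      = GL_ideal n r s +>\<^bsub>GL_free n\<^esub> p"
    and "p \<in> carrier (GL_free n)"
proof -
  let ?A = "GL_free n" and ?B = "Fun_GL n r s" and ?S = "{\<sigma>. \<sigma> permutes {1..n}}"
  let ?h = "(+>\<^bsub>?A\<^esub>) (GL_ideal n r s)"
  interpret calg_hom ?A ?B ?h by (rule calg_hom_Fun_GL)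
  let ?x = "\<lambda>\<sigma> k. free_t (f \<sigma> k) (g \<sigma> k)"
  have x: "?x \<sigma> k \<in> carrier ?A" if "\<sigma> \<in> ?S" "k \<in> {1..n}" for \<sigma> k
    using that f g by (intro free_t_mem) blast+
  have "foldr (\<otimes>\<^bsub>?A\<^esub>) (map (?x \<sigma>) ks) \<one>\<^bsub>?A\<^esub> = t_monomial (map (f \<sigma>) ks) (map (g \<sigma>) ks)" for \<sigma> ks
    by (induction ks) (simp_all add: t_monomial_def GL_free_conv)
  then have prod: "ordered_prod ?A n (?x \<sigma>)
      = t_monomial (map (f \<sigma>) [1..<n+1]) (map (g \<sigma>) [1..<n+1])" for \<sigma>
    unfolding ordered_prod_def .
  let ?q = "\<Oplus>\<^bsub>?A\<^esub>\<sigma>\<in>?S. c (inversions n \<sigma>) \<odot>\<^bsub>?A\<^esub> ordered_prod ?A n (?x \<sigma>)"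
  have summand: "c (inversions n \<sigma>) \<odot>\<^bsub>?A\<^esub> ordered_prod ?A n (?x \<sigma>) \<in> carrier ?A" if "\<sigma> \<in> ?S" for \<sigma>
    using that by (intro smult_closed ordered_prod_closed x)
  then have q: "?q \<in> carrier ?A"
    by (intro R.finsum_closed Pi_I)
  have p: "?q = p"
    using summand unfolding p_def prod unfolding GL_free_conv
    by (intro finsum_free_algebra_eq) (simp_all only: free_algebra_sel)
  show "p \<in> carrier ?A"
    using q unfolding p .
  show "(\<Oplus>\<^bsub>?B\<^esub>\<sigma>\<in>?S. c (inversions n \<sigma>) \<odot>\<^bsub>?B\<^esub>
      ordered_prod ?B n (\<lambda>k. GL_t n r s (f \<sigma> k) (g \<sigma> k))) = ?h p"
    unfolding p[symmetric] GL_t_def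
    by (subst hom_weighted_ordered_prods[OF x]) simp_all
qed

lemma map_permutes_in_permutations_of_set:
  "\<eta> permutes {1..n} \<Longrightarrow> map \<eta> [1..<n+1] \<in> permutations_of_set {1..n}"
  using bij_betw_apply[OF bij_betw_permutes_permutations_of_set] by blast

lemma qdet_column_expansion:
  assumes "r \<noteq> 0" "s \<noteq> 0" "r \<noteq> s" and "\<forall>k\<in>{1..n}. qint r s k \<noteq> 0"
    and \<eta>: "\<eta> permutes {1..n}"
  shows "qdet n r s = ((- s) powi (- int (inversions n \<eta>))) \<odot>\<^bsub>Fun_GL n r s\<^esub>
    (\<Oplus>\<^bsub>Fun_GL n r s\<^esub>\<sigma>\<in>{\<sigma>. \<sigma> permutes {1..n}}. ((- s) ^ inversions n \<sigma>) \<odot>\<^bsub>Fun_GL n r s\<^esub>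
      ordered_prod (Fun_GL n r s) n (\<lambda>k. GL_t n r s (\<sigma> k) (\<eta> k)))"
proof -
  let ?ys = "map \<eta> [1..<n+1]"
  let ?d = "(- s) powi (- int (inversions n \<eta>))"
  have range: "\<forall>\<sigma>. \<sigma> permutes {1..n} \<longrightarrow> \<sigma> ` {1..n} \<subseteq> {1..n}"
    by (simp add: permutes_image)
  then have "\<forall>\<sigma>. \<sigma> permutes {1..n} \<longrightarrow> \<eta> ` {1..n} \<subseteq> {1..n}" using \<eta> by blast
  note coset = signed_sum_eq_coset[where c = "\<lambda>l. (- s) ^ l" and f = "\<lambda>\<sigma>. \<sigma>" and g = "\<lambda>_. \<eta>"
      and n = n, OF range this]
  have "?d = inverse ((- s) ^ list_inversions ?ys)"
    by (simp only: list_inversions_map[OF \<eta>] power_int_minus power_int_of_nat)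
  then have "qdet_free n r s - scalar ?d * (\<Sum>\<sigma> | \<sigma> permutes {1..n}.
      scalar ((- s) ^ inversions n \<sigma>) * t_monomial (map \<sigma> [1..<n+1]) ?ys)
    \<in> GL_ideal n r s"
    using qdet_free_column[OF assms(1-4) map_permutes_in_permutations_of_set[OF \<eta>]]
      sum_permutes_conv_lists[where g = "\<lambda>l xs. scalar ((- s) ^ l) * t_monomial xs ?ys"]
    by (simp only:)
  then show ?thesis
    unfolding qdet_eq_coset coset(1) Fun_GL_smult_coset(1)[OF coset(2)]
    using Fun_GL_smult_coset(2)[OF coset(2)] qdet_free_mem unfolding GL_free_conv
    by (intro coset_eqI ideal_GL_ideal[unfolded GL_free_conv])
qed

lemma qdet_row_expansion:
  assumes "r \<noteq> 0" "r \<noteq> s" and "\<forall>k\<in>{1..n}. qint r s k \<noteq> 0"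
    and \<eta>: "\<eta> permutes {1..n}"
  shows "qdet n r s = ((- r) ^ inversions n \<eta>) \<odot>\<^bsub>Fun_GL n r s\<^esub>
    (\<Oplus>\<^bsub>Fun_GL n r s\<^esub>\<sigma>\<in>{\<sigma>. \<sigma> permutes {1..n}}.
      ((- r) powi (- int (inversions n \<sigma>))) \<odot>\<^bsub>Fun_GL n r s\<^esub>
        ordered_prod (Fun_GL n r s) n (\<lambda>k. GL_t n r s (\<eta> k) (\<sigma> k)))"
proof -
  let ?xs = "map \<eta> [1..<n+1]"
  let ?d = "(- r) ^ inversions n \<eta>"
  have range: "\<forall>\<sigma>. \<sigma> permutes {1..n} \<longrightarrow> \<sigma> ` {1..n} \<subseteq> {1..n}"
    by (simp add: permutes_image)
  then have "\<forall>\<sigma>. \<sigma> permutes {1..n} \<longrightarrow> \<eta> ` {1..n} \<subseteq> {1..n}" using \<eta> by blast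
  note coset = signed_sum_eq_coset[where c = "\<lambda>l. (- r) powi (- int l)" and f = "\<lambda>_. \<eta>"
      and g = "\<lambda>\<sigma>. \<sigma>" and n = n, OF this range]
  have "?d = inverse (inverse (- r) ^ list_inversions ?xs)"
    by (simp only: list_inversions_map[OF \<eta>] power_inverse[symmetric] inverse_inverse_eq)
  moreover have "(- r) powi (- int l) = inverse (- r) ^ l" for l
    by (simp only: power_int_minus power_int_of_nat power_inverse)
  ultimately have "qdet_free n r s - scalar ?d * (\<Sum>\<sigma> | \<sigma> permutes {1..n}.
      scalar ((- r) powi (- int (inversions n \<sigma>))) *
        t_monomial ?xs (map \<sigma> [1..<n+1])) \<in> GL_ideal n r s"
    using qdet_free_row[OF assms(1-3) map_permutes_in_permutations_of_set[OF \<eta>]]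
      sum_permutes_conv_lists[where g = "\<lambda>l ys. scalar (inverse (- r) ^ l) * t_monomial ?xs ys"]
    by (simp only:)
  then show ?thesis
    unfolding qdet_eq_coset coset(1) Fun_GL_smult_coset(1)[OF coset(2)]
    using Fun_GL_smult_coset(2)[OF coset(2)] qdet_free_mem unfolding GL_free_conv
    by (intro coset_eqI ideal_GL_ideal[unfolded GL_free_conv])
qed

theorem proposition2p8:
  fixes n :: nat and r s :: complex
  assumes "n \<ge> 2"
    and "r \<noteq> 0" and "s \<noteq> 0" and "r \<noteq> s"
    and "\<forall>k\<in>{1..n}. qint r s k \<noteq> 0"
  shows "(\<forall>\<eta>. \<eta> permutes {1..n} \<longrightarrow>
      qdet n r s =
        ((- s) powi (- int (inversions n \<eta>))) \<odot>\<^bsub>Fun_GL n r s\<^esub>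
          (\<Oplus>\<^bsub>Fun_GL n r s\<^esub>\<sigma>\<in>{\<sigma>. \<sigma> permutes {1..n}}.
            ((- s) ^ inversions n \<sigma>) \<odot>\<^bsub>Fun_GL n r s\<^esub>
              ordered_prod (Fun_GL n r s) n (\<lambda>k. GL_t n r s (\<sigma> k) (\<eta> k)))
      \<and> qdet n r s =
        ((- r) ^ inversions n \<eta>) \<odot>\<^bsub>Fun_GL n r s\<^esub>
          (\<Oplus>\<^bsub>Fun_GL n r s\<^esub>\<sigma>\<in>{\<sigma>. \<sigma> permutes {1..n}}.
            ((- r) powi (- int (inversions n \<sigma>))) \<odot>\<^bsub>Fun_GL n r s\<^esub>
              ordered_prod (Fun_GL n r s) n (\<lambda>k. GL_t n r s (\<eta> k) (\<sigma> k))))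
    \<and> qdet n r s =
        (\<Oplus>\<^bsub>Fun_GL n r s\<^esub>\<sigma>\<in>{\<sigma>. \<sigma> permutes {1..n}}.
          ((- s) ^ inversions n \<sigma>) \<odot>\<^bsub>Fun_GL n r s\<^esub>
            ordered_prod (Fun_GL n r s) n (\<lambda>k. GL_t n r s (\<sigma> k) k))
    \<and> qdet n r s =
        (\<Oplus>\<^bsub>Fun_GL n r s\<^esub>\<sigma>\<in>{\<sigma>. \<sigma> permutes {1..n}}.
          ((- r) powi (- int (inversions n \<sigma>))) \<odot>\<^bsub>Fun_GL n r s\<^esub>
            ordered_prod (Fun_GL n r s) n (\<lambda>k. GL_t n r s k (\<sigma> k)))"
proof (intro conjI allI impI)
  note columns = qdet_column_expansion[OF assms(2-5)] and rows = qdet_row_expansion[OF assms(2,4,5)]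
  fix \<eta> :: "nat \<Rightarrow> nat"
  assume \<eta>: "\<eta> permutes {1..n}"
  show "qdet n r s = ((- s) powi (- int (inversions n \<eta>))) \<odot>\<^bsub>Fun_GL n r s\<^esub>
      (\<Oplus>\<^bsub>Fun_GL n r s\<^esub>\<sigma>\<in>{\<sigma>. \<sigma> permutes {1..n}}. ((- s) ^ inversions n \<sigma>) \<odot>\<^bsub>Fun_GL n r s\<^esub>
        ordered_prod (Fun_GL n r s) n (\<lambda>k. GL_t n r s (\<sigma> k) (\<eta> k)))"
    by (rule columns[OF \<eta>])
  show "qdet n r s = ((- r) ^ inversions n \<eta>) \<odot>\<^bsub>Fun_GL n r s\<^esub>
      (\<Oplus>\<^bsub>Fun_GL n r s\<^esub>\<sigma>\<in>{\<sigma>. \<sigma> permutes {1..n}}.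
        ((- r) powi (- int (inversions n \<sigma>))) \<odot>\<^bsub>Fun_GL n r s\<^esub>
          ordered_prod (Fun_GL n r s) n (\<lambda>k. GL_t n r s (\<eta> k) (\<sigma> k)))"
    by (rule rows[OF \<eta>])
next
  have "{(i, j). i \<in> {1..n} \<and> j \<in> {1..n} \<and> i < j \<and> (id i :: nat) > id j} = {}" by auto
  then have inversions_id: "inversions n id = 0"
    unfolding inversions_def by (simp only: card.empty)
  have range: "\<forall>\<sigma>. \<sigma> permutes {1..n} \<longrightarrow> \<sigma> ` {1..n} \<subseteq> {1..n}"
    by (simp add: permutes_image)
  have range_id: "\<forall>\<sigma>. \<sigma> permutes {1..n} \<longrightarrow> (\<lambda>k. k) ` {1..n} \<subseteq> {1..n}" by simp
  note columns = qdet_column_expansion[OF assms(2-5) permutes_id]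
    and column_coset = signed_sum_eq_coset[where c = "\<lambda>l. (- s) ^ l" and f = "\<lambda>\<sigma>. \<sigma>"
      and g = "\<lambda>_ k. k" and n = n, OF range range_id]
  show "qdet n r s = (\<Oplus>\<^bsub>Fun_GL n r s\<^esub>\<sigma>\<in>{\<sigma>. \<sigma> permutes {1..n}}.
      ((- s) ^ inversions n \<sigma>) \<odot>\<^bsub>Fun_GL n r s\<^esub>
        ordered_prod (Fun_GL n r s) n (\<lambda>k. GL_t n r s (\<sigma> k) k))"
    using columns unfolding inversions_id id_apply column_coset(1) Fun_GL_smult_coset(1)[OF column_coset(2)]
    by (simp only: of_nat_0 minus_zero power_int_0_right single_one mult_1_left)
  note rows = qdet_row_expansion[OF assms(2,4,5) permutes_id]
    and row_coset = signed_sum_eq_coset[where c = "\<lambda>l. (- r) powi (- int l)" and f = "\<lambda>_ k. k"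
      and g = "\<lambda>\<sigma>. \<sigma>" and n = n, OF range_id range]
  show "qdet n r s = (\<Oplus>\<^bsub>Fun_GL n r s\<^esub>\<sigma>\<in>{\<sigma>. \<sigma> permutes {1..n}}.
      ((- r) powi (- int (inversions n \<sigma>))) \<odot>\<^bsub>Fun_GL n r s\<^esub>
        ordered_prod (Fun_GL n r s) n (\<lambda>k. GL_t n r s k (\<sigma> k)))"
    using rows unfolding inversions_id id_apply row_coset(1) Fun_GL_smult_coset(1)[OF row_coset(2)]
    by (simp only: power_0 single_one mult_1_left)
qed

end
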